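(* For every positive integer $n$, the number of signed partitions $\sigma=(\pi,\nu)$ of $n$ such that (i) $\pi_1$, the largest positive part, is even, (ii) the integers $1,2,\dots,\frac{\pi_1}{2}-1$ all appear as positive parts an even number of times and at least twice, (iii) the integers $\frac{\pi_1}{2},\frac{\pi_1}{2}+1,\dots,\pi_1$ all appear as positive parts at least once, and (iv) there are exactly $\frac{\pi_1}{2}$ negative parts (counted with multiplicity), each $\equiv 1\pmod 3$ and $\leq \frac{3\pi_1}{2}-2$, with the negative parts greater than $1$ occurring at most once, equals the number of (ordinary) partitions of $n$ into parts congruent to $\pm 2, \pm 3, \pm 4, \pm 5, \pm 6 \pmod{18}$.
   Context: A partition $\lambda$ of length $\ell=\ell(\lambda)$ is an $\ell$-tuple $(\lambda_1,\dots,\lambda_\ell)$ of positive integers (its parts) with $\lambda_i\geq\lambda_{i+1}$ for $1\le i\le \ell-1$; its weight is $|\lambda|=\sum_i\lambda_i$, and it is a partition of $n$ if $|\lambda|=n$. A signed partition $\sigma$ of an integer $n$ is a pair $(\pi,\nu)$ of partitions with $n=|\pi|-|\nu|$; the parts of $\pi$ are called the positive parts of $\sigma$ and the parts of $\nu$ (which are positive integers) are called the negative parts of $\sigma$. In the claim $\pi$ is nonempty (it has a largest part $\pi_1$); a list of integers such as $1,2,\dots,\frac{\pi_1}{2}-1$ is empty when its upper end is $0$. *)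

theory Defs
  imports "HOL-Number_Theory.Cong"
begin

text \<open>A partition is the tuple (list) of its parts in weakly decreasing order; its length is
  \<^const>\<open>length\<close>, its weight \<^const>\<open>sum_list\<close>, and for a nonempty partition
  its largest part is \<^const>\<open>hd\<close>.\<close>

definition is_partition :: "nat list \<Rightarrow> bool" where
  "is_partition xs \<longleftrightarrow> sorted_wrt (\<ge>) xs \<and> (\<forall>x\<in>set xs. 0 < x)"

definition partition_of :: "nat \<Rightarrow> nat list \<Rightarrow> bool" where
  "partition_of n xs \<longleftrightarrow> is_partition xs \<and> sum_list xs = n"

definition signed_partition_of :: "int \<Rightarrow> nat list \<times> nat list \<Rightarrow> bool" where
  "signed_partition_of n \<sigma> \<longleftrightarrow>
     is_partition (fst \<sigma>) \<and> is_partition (snd \<sigma>) \<and>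
     n = int (sum_list (fst \<sigma>)) - int (sum_list (snd \<sigma>))"

end

theory Submission
  imports Defs "HOL-Library.Multiset" "HOL-Computational_Algebra.Formal_Laurent_Series"
begin

text \<open>
  Write \<open>2m\<close> for the largest positive part and \<open>Q(k) = (1 - q) \<cdots> (1 - q^k)\<close>. For fixed \<open>m\<close> the positive
  parts contribute \<open>q^(2j)/(1 - q^(2j))\<close> for each \<open>j < m\<close> and \<open>q^j/(1 - q^j)\<close> for each \<open>j\<close> from \<open>m\<close> to
  \<open>2m\<close>. The negative parts are given by the set \<open>J\<close> of those \<open>j\<close> in \<open>{1, ..., m-1}\<close> for which \<open>3j + 1\<close>
  occurs; the other \<open>m - |J|\<close> of them equal \<open>1\<close>, so that they contribute \<open>q^(-m)\<close> times the product of
  all \<open>1 + q^(-3j)\<close>. After cancellation the signed partitions have the generating function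
  \<open>\<Sum>m. q^(m\<^sup>2+m) c(m) / Q(2m)\<close>, where \<open>c(m)\<close> is the product of \<open>1 - q^j + q^(2j)\<close> over \<open>0 < j < m\<close>, and
  it remains to show that this series is the product of \<open>1/(1 - q^j)\<close> over the \<open>j\<close> congruent to
  \<open>\<plusminus>2, \<dots>, \<plusminus>6\<close> modulo \<open>18\<close>. This is an identity of Rogers-Ramanujan type, and Bailey's method applies.

  The term \<open>c(m)/Q(2m)\<close> is the sum over all integers \<open>k\<close> of
  \<open>(q^T(3k) - q^T(3k+2)) / (Q(m-3k) Q(m+3k+1))\<close> with \<open>T(r) = r(r-1)/2\<close> (\<open>bailey_pair\<close>); only
  multiples of three occur because \<open>1 - q^j + q^(2j) = (1 - \<omega>q^j)(1 - q^j/\<omega>)\<close> for a primitive sixth root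
  of unity \<open>\<omega>\<close>, and the coefficients in the expansion in powers of \<open>\<omega>\<close> combine with period three, since
  \<open>-\<omega>\<close> is a cube root of unity. Summing over \<open>m\<close> with weight \<open>q^(m\<^sup>2+m)\<close> is Cauchy's Durfee rectangle identity
  (\<open>durfee_sum\<close>) and gives \<open>\<Theta>/Q(\<infinity>)\<close>, where \<open>\<Theta>\<close> is the sum over all integers \<open>k\<close> of
  \<open>q^((27k\<^sup>2+3k)/2) - q^((27k\<^sup>2+15k+2)/2)\<close>. The quintuple product identity in base \<open>q^9\<close> at
  \<open>z = -q\<close> evaluates \<open>\<Theta>\<close> as the product of \<open>1 - q^j\<close> over the \<open>j\<close> congruent to \<open>0, \<plusminus>1, \<plusminus>7, \<plusminus>8, 9\<close>
  modulo \<open>18\<close>, and dividing by \<open>Q(\<infinity>)\<close> leaves the product that was claimed.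

  Infinite products never occur. Each identity is proved in a finite form, which is a statement about
  a single element \<open>q\<close> of a field; it is then read in the field of formal Laurent series and transported
  to power series, where any given number of coefficients of the limit can be compared.
\<close>

section \<open>A Bailey pair and its summation\<close>

definition qfact :: "'a::comm_ring_1 \<Rightarrow> nat \<Rightarrow> 'a" where
  "qfact q n = (\<Prod>i=1..n. 1 - q ^ i)"

text \<open>Setting \<open>1/Q(k)\<close> to \<open>0\<close> for negative \<open>k\<close> is what \<open>1/Q(k-1) = (1 - q^k)/Q(k)\<close> forces at \<open>k = 0\<close>. It makes
  \<open>rqfact_step\<close> hold for all integers and lets sums end by themselves.\<close>

definition rqfact :: "'a::{comm_ring_1,inverse} \<Rightarrow> int \<Rightarrow> 'a" where
  "rqfact q k = (if k < 0 then 0 else inverse (qfact q (nat k)))"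

definition qpoch :: "'a::comm_ring_1 \<Rightarrow> 'a \<Rightarrow> nat \<Rightarrow> 'a" where
  "qpoch z q n = (\<Prod>i<n. 1 - z * q ^ i)"

definition tri :: "int \<Rightarrow> int" where "tri r = r * (r - 1) div 2"

lemma qfact_0 [simp]: "qfact q 0 = 1"
  and qfact_Suc: "qfact q (Suc n) = qfact q n * (1 - q ^ Suc n)"
  by (simp_all add: qfact_def)

lemma rqfact_0 [simp]: "rqfact (q :: 'a :: field) 0 = 1"
  by (simp add: rqfact_def)

lemma rqfact_neg [simp]: "k < 0 \<Longrightarrow> rqfact q k = 0"
  by (simp add: rqfact_def)

text \<open>What dividing by q-factorials and by powers of \<open>q\<close> requires.\<close>

definition generic :: "'a::field \<Rightarrow> bool" where
  "generic q \<longleftrightarrow> q \<noteq> 0 \<and> (\<forall>k>0. q ^ k \<noteq> 1)"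

lemma genericD:
  assumes "generic q"
  shows "q \<noteq> 0" "0 < k \<Longrightarrow> q ^ k \<noteq> 1"
  using assms by (auto simp: generic_def)

lemma rqfact_step:
  fixes q :: "'a::field"
  assumes q: "generic q"
  shows "rqfact q (k - 1) = (1 - q powi k) * rqfact q k"
proof -
  consider "k < 0" | "k = 0" | n where "k = int (Suc n)"
    by (metis gr0_conv_Suc linorder_less_linear pos_int_cases)
  thus ?thesis
  proof cases
    case 3
    have "1 - q ^ Suc n \<noteq> 0" using genericD(2)[OF q, of "Suc n"] by auto
    moreover have "rqfact q (int (Suc n)) = inverse (qfact q n) * inverse (1 - q ^ Suc n)"
      unfolding rqfact_def nat_int qfact_Suc by simp
    moreover have "rqfact q (int (Suc n) - 1) = inverse (qfact q n)" by (simp add: rqfact_def)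
    ultimately show ?thesis unfolding 3 power_int_of_nat by (simp del: power_Suc)
  qed auto
qed

lemma tri_step: "tri (r + 1) = tri r + r"
proof -
  have "(r + 1) * (r + 1 - 1) = r * (r - 1) + r * 2" by (simp add: algebra_simps)
  thus ?thesis unfolding tri_def by simp
qed

lemma two_tri: "2 * tri r = r * (r - 1)"
proof -
  have "even (r * (r - 1))" by simp
  thus ?thesis unfolding tri_def by simp
qed

text \<open>The usual form of the numerator is \<open>q^T(r) (1 - q^(2r+1))\<close>, as \<open>T(r+2) = T(r) + 2r + 1\<close>; written as a
  difference it has no negative exponents when \<open>r\<close> is negative.\<close>

definition bailey_term :: "'a::field \<Rightarrow> nat \<Rightarrow> int \<Rightarrow> 'a" where
  "bailey_term q m r = (q powi tri r - q powi tri (r + 2)) * rqfact q (int m - r) * rqfact q (int m + r + 1)"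

text \<open>Let \<open>U(r)\<close> be \<open>(-1)^r\<close> times the coefficient of \<open>z^r\<close> in \<open>(z; q)_m (1/z; q)_m / Q(2m)\<close>. Passing from \<open>m\<close> to
  \<open>m + 1\<close> multiplies the numerator by \<open>1 + q^(2m) - q^m (z + 1/z)\<close>, so \<open>U\<close> satisfies this three-term
  recurrence. The terms here are the differences \<open>U(r) - U(r+1)\<close> and inherit it.
  The proof expresses everything through \<open>q^m\<close>, \<open>q^r\<close> and the two largest q-factorials.\<close>

lemma bailey_term_rec:
  fixes q :: "'a::field"
  assumes q: "generic q"
  shows "(1 - q ^ (2*m+1)) * (1 - q ^ (2*m+2)) * bailey_term q (Suc m) r
      = (1 + q ^ (2*m)) * bailey_term q m r + q ^ m * (bailey_term q m (r - 1) + bailey_term q m (r + 1))"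
proof -
  note q0 = genericD(1)[OF q]
  define x where "x = q ^ m"
  define y where "y = q powi r"
  define T where "T = q powi tri r"
  define u where "u = rqfact q (int m + 1 - r)"
  define v where "v = rqfact q (int m + r + 2)"
  have y0: "y \<noteq> 0" using q0 by (simp add: y_def)
  have T1: "q powi tri (r+1) = T * y"
    using q0 by (simp add: tri_step power_int_add T_def y_def)
  have T2: "q powi tri (r+2) = T * y^2 * q"
    using q0 tri_step[of "r+1"] T1
    by (simp add: power_int_add y_def power2_eq_square ac_simps)
  have T3: "q powi tri (r+3) = T * y^3 * q^3"
    using q0 tri_step[of "r+2"] T2
    by (simp add: power_int_add y_def power2_eq_square power3_eq_cube ac_simps)
  have T0: "q powi tri (r-1) = T * q / y"
    using q0 tri_step[of "r-1"]
    by (simp add: T_def power_int_add power_int_diff y_def)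
  have xm: "q powi (int m) = x" by (simp add: x_def)
  have u1: "rqfact q (int m - r) = (1 - q*x/y) * u"
    using rqfact_step[OF q, of "int m + 1 - r"] q0 xm
    by (simp add: u_def y_def power_int_add power_int_diff mult.commute)
  have u2: "rqfact q (int m - r - 1) = (1 - x/y) * (1 - q*x/y) * u"
    using rqfact_step[OF q, of "int m - r"] q0 xm u1
    by (simp add: y_def power_int_diff)
  have v1: "rqfact q (int m + r + 1) = (1 - q^2*x*y) * v"
    using rqfact_step[OF q, of "int m + r + 2"] q0 xm
    by (simp add: v_def y_def power_int_add ac_simps)
  have v2: "rqfact q (int m + r) = (1 - q*x*y) * (1 - q^2*x*y) * v"
    using rqfact_step[OF q, of "int m + r + 1"] q0 xm v1
    by (simp add: y_def power_int_add ac_simps)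
  have b0: "bailey_term q (Suc m) r = (T - T*y^2*q) * u * v"
    by (simp add: bailey_term_def T2 u_def v_def T_def ac_simps)
  have b1: "bailey_term q m r = (T - T*y^2*q) * ((1 - q*x/y) * u) * ((1 - q^2*x*y) * v)"
    by (simp add: bailey_term_def T2 u1 v1 flip: T_def)
  have b2: "bailey_term q m (r - 1) = (T*q/y - T*y) * u * ((1 - q*x*y) * (1 - q^2*x*y) * v)"
  proof -
    have "int m - (r - 1) = int m + 1 - r" "int m + (r - 1) + 1 = int m + r" "r - 1 + 2 = r + 1" by simp_all
    thus ?thesis unfolding bailey_term_def by (simp only: T0 T1 v2 u_def)
  qed
  have b3: "bailey_term q m (r + 1) = (T*y - T*y^3*q^3) * ((1 - x/y) * (1 - q*x/y) * u) * v"
  proof -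
    have "int m - (r + 1) = int m - r - 1" "int m + (r + 1) + 1 = int m + r + 2" "r + 1 + 2 = r + 3" by simp_all
    thus ?thesis unfolding bailey_term_def by (simp only: T1 T3 u2 v_def)
  qed
  have e: "q ^ (2*m) = x^2" "q ^ (2*m+1) = x^2*q" "q ^ (2*m+2) = x^2*q^2"
    by (simp_all add: x_def power_add power2_eq_square mult_2)
  show ?thesis unfolding b0 b1 b2 b3 e x_def[symmetric] using y0
    by (simp add: field_simps power2_eq_square power3_eq_cube)
qed

lemma bailey_term_reflect:
  fixes q :: "'a::field"
  shows "bailey_term q m (- 1 - r) = - bailey_term q m r"
proof -
  have "tri (-1 - r) = tri (r + 2)" "tri (-1 - r + 2) = tri r"
    using two_tri[of "-1-r"] two_tri[of "r+2"] two_tri[of "-1-r+2"] two_tri[of r]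
    by (simp_all add: algebra_simps)
  thus ?thesis by (simp add: bailey_term_def algebra_simps)
qed

text \<open>The product of the values of the sixth cyclotomic polynomial at \<open>q, q^2, \<dots>, q^(m-1)\<close>.\<close>

definition phi6_prod :: "'a::comm_ring_1 \<Rightarrow> nat \<Rightarrow> 'a" where
  "phi6_prod q m = (\<Prod>j=1..<m. 1 - q ^ j + q ^ (2*j))"

lemma sum_int_reflect:
  fixes f :: "int \<Rightarrow> 'a::comm_monoid_add"
  shows "(\<Sum>k=-L..L. f (-k)) = (\<Sum>k=-L..L. f k)"
  by (rule sum.reindex_bij_witness[of _ uminus uminus]) auto

text \<open>Summing the recurrence over \<open>r = 3k\<close> brings in the sums over \<open>r = 3k - 1\<close> and \<open>r = 3k + 1\<close>. By the
  antisymmetry under \<open>r \<mapsto> -1 - r\<close> the former is the negative of the sum over multiples of three and the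
  latter vanishes, so the sum is multiplied by \<open>1 + q^(2m) - q^m\<close>, which is the new factor of
  \<open>phi6_prod\<close>. The bound \<open>L\<close> is only required to cover all nonzero terms.\<close>

lemma bailey_pair:
  fixes q :: "'a::field"
  assumes q: "generic q" and two: "(2::'a) \<noteq> 0"
  assumes L: "int m < L"
  shows "phi6_prod q m * rqfact q (2 * int m) = (\<Sum>k=-L..L. bailey_term q m (3*k))"
  using L
proof (induction m)
  note q0 = genericD(1)[OF q]
  case 0
  have "bailey_term q 0 (3*k) = (if k = 0 then 1 else 0)" for k
  proof (cases "k = 0")
    case True
    thus ?thesis using rqfact_step[OF q, of 1] q0 by (simp add: bailey_term_def tri_def algebra_simps)
  next
    case False
    hence "- (3*k) < 0 \<or> 3*k+1 < 0" by arith
    thus ?thesis using False by (auto simp: bailey_term_def)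
  qed
  thus ?case using 0 by (simp add: phi6_prod_def)
next
  case (Suc m)
  let ?S = "\<lambda>f. \<Sum>k=-L..L. f k"
  have IH: "phi6_prod q m * rqfact q (2 * int m) = ?S (\<lambda>k. bailey_term q m (3*k))" using Suc by simp
  have m2: "?S (\<lambda>k. bailey_term q m (3*k-1)) = - ?S (\<lambda>k. bailey_term q m (3*k))"
  proof -
    have "?S (\<lambda>k. bailey_term q m (3*k-1)) = ?S (\<lambda>k. bailey_term q m (3*(-k)-1))"
      by (rule sum_int_reflect[symmetric])
    also have "\<dots> = ?S (\<lambda>k. - bailey_term q m (3*k))"
    proof (intro sum.cong refl)
      fix k :: int have "3*(-k)-1 = -1 - 3*k" by simp
      thus "bailey_term q m (3*(-k)-1) = - bailey_term q m (3*k)" by (simp only: bailey_term_reflect)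
    qed
    finally show ?thesis by (simp add: sum_negf)
  qed
  have m1: "?S (\<lambda>k. bailey_term q m (3*k+1)) = 0"
  proof -
    let ?f = "\<lambda>k. bailey_term q m (3*k+1)"
    have z: "?f k = 0" if "k = L \<or> k = -L-1 \<or> k = - L" for k
      using that Suc.prems by (auto simp: bailey_term_def)
    have "?S ?f = (\<Sum>k=-L..L-1. ?f k)"
      using Suc.prems z by (intro sum.mono_neutral_right) auto
    also have "\<dots> = (\<Sum>k=-L..L-1. ?f (-1-k))"
      by (rule sum.reindex_bij_witness[of _ "\<lambda>k. -1-k" "\<lambda>k. -1-k"]) auto
    also have "\<dots> = (\<Sum>k=-L..L-1. - ?f k)"
    proof (intro sum.cong refl)
      fix k :: int have "3*(-1-k)+1 = -1 - (3*k+1)" by simp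
      thus "?f (-1-k) = - ?f k" by (simp only: bailey_term_reflect)
    qed
    also have "\<dots> = - ?S ?f"
    proof -
      have "?S ?f = (\<Sum>k=-L..L-1. ?f k)"
        using Suc.prems z by (intro sum.mono_neutral_right) auto
      thus ?thesis by (simp add: sum_negf)
    qed
    finally have "2 * ?S ?f = 0" unfolding eq_neg_iff_add_eq_0 mult_2 .
    thus ?thesis using two by simp
  qed
  define P where "P = (1 - q ^ (2*m+1)) * (1 - q ^ (2*m+2))"
  have P0: "P \<noteq> 0" using genericD(2)[OF q, of "2*m+1"] genericD(2)[OF q, of "2*m+2"] by (auto simp: P_def simp del: power_Suc)
  have iq: "rqfact q (2 * int m) = P * rqfact q (2 * int (Suc m))"
  proof -
    have "int (2*m+1) - 1 = 2 * int m" "int (2*m+2) - 1 = int (2*m+1)" "int (2*m+2) = 2 * int (Suc m)"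
      by simp_all
    thus ?thesis
      using rqfact_step[OF q, of "int (2*m+1)"] rqfact_step[OF q, of "int (2*m+2)"]
      unfolding P_def power_int_of_nat by (simp only: mult.assoc)
  qed
  have new_factor: "phi6_prod q (Suc m) = (1 - q ^ m + q ^ (2*m)) * phi6_prod q m"
    by (cases m) (simp_all add: phi6_prod_def)
  have "P * ?S (\<lambda>k. bailey_term q (Suc m) (3*k))
      = (1 + q ^ (2*m)) * ?S (\<lambda>k. bailey_term q m (3*k)) 
        + q ^ m * (?S (\<lambda>k. bailey_term q m (3*k-1)) + ?S (\<lambda>k. bailey_term q m (3*k+1)))"
    unfolding P_def sum_distrib_left bailey_term_rec[OF q] by (simp only: sum.distrib sum_distrib_left distrib_left)
  also have "\<dots> = (1 - q ^ m + q ^ (2*m)) * (phi6_prod q m * rqfact q (2 * int m))"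
    unfolding m1 m2 IH by (simp add: algebra_simps)
  also have "\<dots> = P * (phi6_prod q (Suc m) * rqfact q (2 * int (Suc m)))"
    by (simp add: iq new_factor)
  finally show ?case using P0 by simp
qed

text \<open>Cauchy's identity for Durfee rectangles, with the sizes bounded by \<open>N\<close>: in combinatorial terms \<open>t\<close> is the
  side of the largest \<open>t \<times> (t + k)\<close> rectangle in a Young diagram. The q-Pascal rule splits the sum for \<open>N + 1\<close>
  and \<open>k\<close> in two; term by term the pieces recombine to the sum for \<open>N\<close> and \<open>k + 1\<close>.\<close>

lemma durfee_sum:
  fixes q :: "'a::field" and k :: int
  assumes q: "generic q"
  shows "(\<Sum>t\<le>N. q powi (int t * (int t + k)) * rqfact q (int N - int t) * rqfact q (int t) * rqfact q (int t + k))
       = rqfact q (int N) * rqfact q (int N + k)"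
proof (induction N arbitrary: k)
  case 0
  show ?case by simp
next
  case (Suc N)
  note q0 = genericD(1)[OF q]
  define Q where "Q = q powi (int N + 1)"
  have Q0: "1 - Q \<noteq> 0" using genericD(2)[OF q, of "Suc N"] power_int_of_nat[of q "Suc N"] 
    by (simp add: Q_def add.commute del: power_int_of_nat)
  let ?c = "\<lambda>t. q powi (int t * (int t + k)) * rqfact q (int t + k)"
  let ?a = "\<lambda>t. ?c t * q powi (int t) * rqfact q (int N - int t) * rqfact q (int t)"
  let ?b = "\<lambda>t. ?c t * rqfact q (int N + 1 - int t) * rqfact q (int t - 1)"
  have split: "(1 - Q) * (?c t * rqfact q (int N + 1 - int t) * rqfact q (int t)) = ?a t + ?b t" for t
  proof -
    have Qe: "Q = q powi (int t) * q powi (int N + 1 - int t)"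
      unfolding Q_def using q0 by (subst power_int_add[symmetric]) auto
    have A: "rqfact q (int N - int t) = (1 - q powi (int N + 1 - int t)) * rqfact q (int N + 1 - int t)"
      using rqfact_step[OF q, of "int N + 1 - int t"] by (simp add: algebra_simps)
    show ?thesis
      unfolding rqfact_step[OF q, of "int t"] A Qe by (simp add: algebra_simps)
  qed
  have "(1 - Q) * (\<Sum>t\<le>Suc N. ?c t * rqfact q (int N + 1 - int t) * rqfact q (int t)) = (\<Sum>t\<le>Suc N. ?a t) + (\<Sum>t\<le>Suc N. ?b t)"
    unfolding sum_distrib_left split by (rule sum.distrib)
  also have "(\<Sum>t\<le>Suc N. ?a t) = (\<Sum>t\<le>N. ?a t)" by simp
  also have "(\<Sum>t\<le>Suc N. ?b t) = (\<Sum>t\<le>N. ?b (Suc t))"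
    by (subst sum.atMost_Suc_shift) simp
  also have "(\<Sum>t\<le>N. ?a t) + (\<Sum>t\<le>N. ?b (Suc t)) = (\<Sum>t\<le>N. q powi (int t * (int t + (k+1))) * rqfact q (int N - int t) * rqfact q (int t) * rqfact q (int t + (k+1)))"
    unfolding sum.distrib[symmetric]
  proof (intro sum.cong refl)
    fix t
    define E where "E = q powi (int t * (int t + (k+1)))"
    define y where "y = q powi (int t + (k+1))"
    have 1: "q powi (int t * (int t + k)) * q powi (int t) = E"
      using q0 unfolding E_def by (subst power_int_add[symmetric]) (auto simp: algebra_simps)
    have 2: "q powi (int (Suc t) * (int (Suc t) + k)) = E * y"
      using q0 unfolding E_def y_def by (subst power_int_add[symmetric]) (auto simp: algebra_simps)
    have 3: "rqfact q (int t + k) = (1 - y) * rqfact q (int t + (k+1))"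
      using rqfact_step[OF q, of "int t + (k+1)"] by (simp add: y_def algebra_simps)
    have a: "?a t = E * rqfact q (int t + k) * rqfact q (int N - int t) * rqfact q (int t)"
      by (simp add: 1[symmetric] mult_ac)
    have b: "?b (Suc t) = E * y * rqfact q (int t + (k+1)) * rqfact q (int N - int t) * rqfact q (int t)"
      unfolding 2 by (simp add: algebra_simps)
    show "?a t + ?b (Suc t) = q powi (int t * (int t + (k+1))) * rqfact q (int N - int t) * rqfact q (int t) * rqfact q (int t + (k+1))"
      unfolding a b unfolding 3 E_def[symmetric] by (simp add: algebra_simps)
  qed
  also have "\<dots> = rqfact q (int N) * rqfact q (int N + (k+1))" by (rule Suc.IH)
  also have "rqfact q (int N) = (1 - Q) * rqfact q (int N + 1)"
    using rqfact_step[OF q, of "int N + 1"] by (simp add: Q_def)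
  finally have "(\<Sum>t\<le>Suc N. ?c t * rqfact q (int N + 1 - int t) * rqfact q (int t)) = rqfact q (int N + 1) * rqfact q (int N + (k+1))"
    using Q0 by (simp add: mult.assoc del: sum.atMost_Suc)
  thus ?case by (simp add: algebra_simps del: sum.atMost_Suc)
qed

text \<open>The form in which the identity sums a Bailey pair: put \<open>m = r + t\<close> and \<open>k = 2r + 1\<close>. Both sides are
  invariant under \<open>r \<mapsto> -1 - r\<close>, which covers negative \<open>r\<close>.\<close>

lemma durfee_rectangle_sum:
  fixes q :: "'a::field" and r :: int
  assumes q: "generic q"
  shows "(\<Sum>m\<le>M. q ^ (m^2+m) * rqfact q (int m - r) * rqfact q (int m + r + 1) * rqfact q (int M - int m))
       = q powi (r^2+r) * rqfact q (int M - r) * rqfact q (int M + r + 1)"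
proof -
  note q0 = genericD(1)[OF q]
  have nn: "(\<Sum>m\<le>M. q ^ (m^2+m) * rqfact q (int m - int s) * rqfact q (int m + int s + 1) * rqfact q (int M - int m))
       = q powi ((int s)^2+int s) * rqfact q (int M - int s) * rqfact q (int M + int s + 1)" for s
  proof (cases "s \<le> M")
    case True
    then obtain N where N: "M = s + N" using le_Suc_ex by blast
    have "(\<Sum>m\<le>M. q ^ (m^2+m) * rqfact q (int m - int s) * rqfact q (int m + int s + 1) * rqfact q (int M - int m))
        = (\<Sum>m\<in>{s..M}. q ^ (m^2+m) * rqfact q (int m - int s) * rqfact q (int m + int s + 1) * rqfact q (int M - int m))"
      by (rule sum.mono_neutral_right) auto
    also have "\<dots> = (\<Sum>t\<le>N. q powi ((int s)^2+int s) * (q powi (int t * (int t + (2 * int s + 1))) * rqfact q (int N - int t) * rqfact q (int t) * rqfact q (int t + (2*int s + 1))))"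
    proof (rule sum.reindex_bij_witness[of _ "\<lambda>t. t + s" "\<lambda>m. m - s"])
      fix m assume "m \<in> {s..M}"
      then obtain t where t: "m = t + s" by (metis atLeastAtMost_iff le_Suc_ex add.commute)
      have e: "q ^ (m^2+m) = q powi ((int s)^2+int s) * q powi (int t * (int t + (2 * int s + 1)))"
        using q0 by (subst power_int_add[symmetric], simp, subst power_int_of_nat[symmetric])
          (simp add: t algebra_simps power2_eq_square)
      show "q powi ((int s)^2+int s) * (q powi (int (m-s) * (int (m-s) + (2 * int s + 1))) * rqfact q (int N - int (m-s)) * rqfact q (int (m-s)) * rqfact q (int (m-s) + (2*int s + 1)))
        = q ^ (m^2+m) * rqfact q (int m - int s) * rqfact q (int m + int s + 1) * rqfact q (int M - int m)"
        unfolding e by (simp add: t N algebra_simps)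
    qed (auto simp: N)
    also have "\<dots> = q powi ((int s)^2+int s) * (rqfact q (int N) * rqfact q (int N + (2 * int s + 1)))"
      unfolding sum_distrib_left[symmetric] by (subst durfee_sum[OF q]) auto
    finally show ?thesis by (simp add: N algebra_simps)
  next
    case False
    thus ?thesis by simp
  qed
  show ?thesis
  proof (cases "r \<ge> 0")
    case True
    thus ?thesis using nn[of "nat r"] by simp
  next
    case False
    define s where "s = nat (-1 - r)"
    have r: "r = -1 - int s" using False by (simp add: s_def)
    have "r^2 + r = (int s)^2 + int s" by (simp add: r power2_eq_square algebra_simps)
    thus ?thesis using nn[of s] by (simp add: r algebra_simps)
  qed
qed

text \<open>Inserting the Bailey pair and exchanging the sums. For large \<open>M\<close> this says that
  \<open>\<Sum>m. q^(m\<^sup>2+m) c(m)/Q(2m)\<close> equals \<open>\<Theta>/Q(\<infinity>)\<close>.\<close>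

lemma bailey_sum_finite:
  fixes q :: "'a::field"
  assumes q: "generic q" and two: "(2::'a) \<noteq> 0"
  assumes L: "int M < L"
  shows "(\<Sum>m\<le>M. q ^ (m^2+m) * phi6_prod q m * rqfact q (2 * int m) * rqfact q (int M - int m))
     = (\<Sum>k=-L..L. (q powi (tri (3*k) + (9*k^2+3*k)) - q powi (tri (3*k+2) + (9*k^2+3*k)))
          * rqfact q (int M - 3*k) * rqfact q (int M + 3*k + 1))"
proof -
  note q0 = genericD(1)[OF q]
  have "(\<Sum>m\<le>M. q ^ (m^2+m) * phi6_prod q m * rqfact q (2 * int m) * rqfact q (int M - int m))
     = (\<Sum>m\<le>M. \<Sum>k=-L..L. q ^ (m^2+m) * bailey_term q m (3*k) * rqfact q (int M - int m))"
  proof (intro sum.cong refl)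
    fix m assume "m \<in> {..M}"
    hence *: "phi6_prod q m * rqfact q (2 * int m) = (\<Sum>k=-L..L. bailey_term q m (3*k))"
      using L by (intro bailey_pair[OF q two]) auto
    have "q ^ (m^2+m) * phi6_prod q m * rqfact q (2 * int m) * rqfact q (int M - int m)
        = q ^ (m^2+m) * (phi6_prod q m * rqfact q (2 * int m)) * rqfact q (int M - int m)"
      by (simp only: mult.assoc)
    also have "\<dots> = (\<Sum>k=-L..L. q ^ (m^2+m) * bailey_term q m (3*k) * rqfact q (int M - int m))"
      unfolding * by (simp only: sum_distrib_left sum_distrib_right)
    finally show "q ^ (m^2+m) * phi6_prod q m * rqfact q (2 * int m) * rqfact q (int M - int m) = (\<Sum>k=-L..L. q ^ (m^2+m) * bailey_term q m (3*k) * rqfact q (int M - int m))" .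
  qed
  also have "\<dots> = (\<Sum>k=-L..L. (q powi tri (3*k) - q powi tri (3*k+2)) * (\<Sum>m\<le>M. q ^ (m^2+m) * rqfact q (int m - 3*k) * rqfact q (int m + 3*k + 1) * rqfact q (int M - int m)))"
    unfolding bailey_term_def sum_distrib_left by (subst sum.swap) (simp only: mult_ac)
  also have "\<dots> = (\<Sum>k=-L..L. (q powi (tri (3*k) + (9*k^2+3*k)) - q powi (tri (3*k+2) + (9*k^2+3*k)))
          * rqfact q (int M - 3*k) * rqfact q (int M + 3*k + 1))"
  proof (intro sum.cong refl)
    fix k :: int
    have e: "(3*k)^2 + 3*k = 9*k^2+3*k" by (simp add: power2_eq_square)
    show "(q powi tri (3*k) - q powi tri (3*k+2)) * (\<Sum>m\<le>M. q ^ (m^2+m) * rqfact q (int m - 3*k) * rqfact q (int m + 3*k + 1) * rqfact q (int M - int m))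
      = (q powi (tri (3*k) + (9*k^2+3*k)) - q powi (tri (3*k+2) + (9*k^2+3*k)))
          * rqfact q (int M - 3*k) * rqfact q (int M + 3*k + 1)"
      using q0 unfolding durfee_rectangle_sum[OF q] e by (simp add: power_int_add left_diff_distrib right_diff_distrib mult_ac)
  qed
  finally show ?thesis .
qed

section \<open>A finite form of the quintuple product identity\<close>

lemma qpoch_0 [simp]: "qpoch z q 0 = 1"
  by (simp add: qpoch_def)

lemma qpoch_Suc: "qpoch z q (Suc n) = qpoch z q n * (1 - z * q ^ n)"
  by (simp add: qpoch_def)

lemma qpoch_Suc_shift: "qpoch z q (Suc n) = (1 - z) * qpoch (z * q) q n"
  unfolding qpoch_def by (subst prod.lessThan_Suc_shift) (simp add: mult.assoc)

lemma qpoch_add: "qpoch z q (m + n) = qpoch z q m * qpoch (z * q ^ m) q n"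
  by (induction n) (simp_all add: qpoch_Suc power_add mult_ac)

text \<open>A finite form of the quintuple product identity due to Chen, Chu and Gu.
  It is proved by the method of Wilf and Zeilberger: with
  \<open>Q = q^(N+1)\<close>, the summands for \<open>N + 1\<close> times \<open>(1 - zQ)(1 - Q)\<close> differ from those for \<open>N\<close> by a
  telescoping difference, whose certificate is \<open>g\<close> below.\<close>

lemma quintuple_finite:
  fixes q z :: "'a::field"
  assumes q: "generic q" and z: "\<And>i. z^2 * q ^ i \<noteq> 1"
  shows "(\<Sum>k\<le>N. (1 + z * q ^ k) * z ^ k * q ^ (k^2) * rqfact q (int k) * rqfact q (int N - int k)
            * inverse (qpoch (z^2 * q ^ k) q (Suc N)))
       = rqfact q (int N) * inverse (qpoch z q (Suc N))"
proof (induction N)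
  case 0
  have "1 + z \<noteq> 0"
  proof
    assume "1 + z = 0"
    hence "z = -1" by (simp add: add_eq_0_iff)
    thus False using z[of 0] by simp
  qed
  moreover have "1 - z^2 = (1 - z) * (1 + z)" by (simp add: algebra_simps power2_eq_square)
  ultimately show ?case by (simp add: qpoch_Suc)
next
  case (Suc N)
  let ?s = "\<lambda>N k. (1 + z * q ^ k) * z ^ k * q ^ (k^2) * rqfact q (int k) * rqfact q (int N - int k)
            * inverse (qpoch (z^2 * q ^ k) q (Suc N))"
  define Q where "Q = q ^ Suc N"
  define g where "g = (\<lambda>k. - Q * z ^ k * q ^ (k^2) / q ^ k * rqfact q (int k - 1)
     * rqfact q (int N + 1 - int k) * inverse (qpoch (z^2 * q ^ k) q (Suc N)))"
  have zQ: "1 - z * Q \<noteq> 0"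
  proof
    assume "1 - z * Q = 0"
    hence "(z * Q)^2 = 1" by simp
    hence "z^2 * q ^ (2 * Suc N) = 1"
      by (simp only: Q_def power_mult_distrib power_mult[symmetric] mult.commute)
    thus False using z by blast
  qed
  have Q1: "1 - Q \<noteq> 0" using genericD(2)[OF q, of "Suc N"] by (simp add: Q_def)
  have step: "(1 - z * Q) * (1 - Q) * ?s (Suc N) k - ?s N k = g (Suc k) - g k" for k
  proof -
    define y where "y = q ^ k"
    define c where "c = z ^ k * q ^ (k^2)"
    define u where "u = rqfact q (int k)"
    define w where "w = rqfact q (int N + 1 - int k)"
    define P where "P = inverse (qpoch (z^2 * y) q (Suc (Suc N)))"
    have y0: "y \<noteq> 0" using genericD(1)[OF q] by (simp add: y_def)
    have u1: "rqfact q (int k - 1) = (1 - y) * u"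
      using rqfact_step[OF q, of "int k"] by (simp add: u_def y_def)
    have "q powi (int N + 1 - int k) = Q / y"
      using genericD(1)[OF q] power_int_of_nat[of q "Suc N"]
      by (simp add: power_int_diff Q_def y_def add.commute del: power_int_of_nat) (simp add: y_def)
    hence w1: "rqfact q (int N - int k) = (1 - Q / y) * w"
      using rqfact_step[OF q, of "int N + 1 - int k"] by (simp add: w_def algebra_simps)
    have ne1: "1 - z^2 * y \<noteq> 0" using z[of k] by (simp add: y_def)
    have ne2: "1 - z^2 * y * Q \<noteq> 0" using z[of "k + Suc N"] by (simp add: y_def Q_def power_add mult_ac)
    have P1: "inverse (qpoch (z^2 * y) q (Suc N)) = (1 - z^2 * y * Q) * P"
      unfolding P_def qpoch_Suc[of _ _ "Suc N"] Q_def[symmetric] using ne2 by simp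
    have P2: "inverse (qpoch (z^2 * (y * q)) q (Suc N)) = (1 - z^2 * y) * P"
      unfolding P_def qpoch_Suc_shift[of _ _ "Suc N"] using ne1 by (simp add: mult.assoc)
    have e1: "q ^ Suc k = y * q" by (simp add: y_def)
    have e2: "q ^ ((Suc k)^2) = q ^ (k^2) * y^2 * q"
      by (simp add: y_def power2_eq_square power_add)
    have s1: "?s (Suc N) k = (1 + z * y) * c * u * w * P"
      by (simp add: y_def[symmetric] c_def u_def w_def P_def add.commute mult_ac)
    have s0: "?s N k = (1 + z * y) * c * u * ((1 - Q / y) * w) * ((1 - z^2 * y * Q) * P)"
      unfolding y_def[symmetric] P1 w1 by (simp only: c_def u_def mult_ac)
    have g0: "g k = - Q * c / y * ((1 - y) * u) * w * ((1 - z^2 * y * Q) * P)"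
      unfolding g_def y_def[symmetric] P1 u1 w_def c_def by (simp only: mult.assoc mult_minus_left)
    have g1: "g (Suc k) = - Q * (c * z * y^2 * q) / (y * q) * u * ((1 - Q / y) * w) * ((1 - z^2 * y) * P)"
    proof -
      have "int (Suc k) - 1 = int k" "int N + 1 - int (Suc k) = int N - int k" by simp_all
      thus ?thesis
        unfolding g_def e1 e2 P2 by (simp only: w1 u_def c_def power_Suc mult_ac)
    qed
    show ?thesis unfolding s0 s1 g0 g1 using y0 genericD(1)[OF q]
      by (simp add: field_simps power2_eq_square)
  qed
  have "(1 - z * Q) * (1 - Q) * (\<Sum>k\<le>Suc N. ?s (Suc N) k) - (\<Sum>k\<le>Suc N. ?s N k) = (\<Sum>k\<le>Suc N. g (Suc k) - g k)"
    unfolding step[symmetric] sum_distrib_left sum_subtractf ..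
  also have "\<dots> = g (Suc (Suc N)) - g 0"
    by (simp only: lessThan_Suc_atMost[symmetric] sum_lessThan_telescope)
  also have "\<dots> = 0" by (simp add: g_def)
  also have "(\<Sum>k\<le>Suc N. ?s N k) = (\<Sum>k\<le>N. ?s N k)" by simp
  also have "\<dots> = rqfact q (int N) * inverse (qpoch z q (Suc N))" by (rule Suc.IH)
  also have "rqfact q (int N) = (1 - Q) * rqfact q (int (Suc N))"
    using rqfact_step[OF q, of "int (Suc N)"] unfolding Q_def power_int_of_nat by simp
  also have "inverse (qpoch z q (Suc N)) = (1 - z * Q) * inverse (qpoch z q (Suc (Suc N)))"
    unfolding qpoch_Suc[of _ _ "Suc N"] Q_def[symmetric] using zQ by simp
  finally have "(1 - z * Q) * (1 - Q) * ((\<Sum>k\<le>Suc N. ?s (Suc N) k) - rqfact q (int (Suc N)) * inverse (qpoch z q (Suc (Suc N)))) = 0"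
    by (simp only: algebra_simps)
  thus ?case using zQ Q1 by (simp only: mult_eq_0_iff right_minus_eq) blast
qed

text \<open>Reading the factors \<open>1 - z/q^i\<close> of the product in reverse order and pulling out \<open>-z/q^i\<close> turns them into
  \<open>1 - q^i/z\<close>. This moves the summation range from \<open>{0, ..., 2L}\<close> to \<open>{-L, ..., L}\<close> below.\<close>

lemma qpoch_reverse:
  fixes q z :: "'a::field"
  assumes "q \<noteq> 0" "z \<noteq> 0"
  shows "qpoch (z / q ^ m) q m = (- z) ^ m * q powi (- tri (int m + 1)) * qpoch (q / z) q m"
proof (induction m)
  case 0
  show ?case by (simp add: tri_def)
next
  case (Suc m)
  define E where "E = q powi (- tri (int (Suc m) + 1))"
  have 1: "qpoch (z / q ^ Suc m) q (Suc m) = (1 - z / q ^ Suc m) * qpoch (z / q ^ m) q m"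
    using assms unfolding qpoch_Suc_shift by simp
  have 2: "q powi (- tri (int m + 1)) = E * q ^ Suc m"
  proof -
    have "- tri (int m + 1) = - tri (int (Suc m) + 1) + int (Suc m)"
      using tri_step[of "int m + 1"] by (simp add: algebra_simps)
    thus ?thesis using assms unfolding E_def by (metis power_int_add power_int_of_nat)
  qed
  show ?case unfolding 1 Suc.IH 2 E_def[symmetric] unfolding qpoch_Suc using assms
    by (simp add: field_simps)
qed

text \<open>The exponents of \<open>\<Theta>\<close> as they arise from the Bailey pair at \<open>r = 3i\<close> and the factor \<open>q^(r\<^sup>2+r)\<close>.\<close>

lemma bailey_exponents:
  fixes i :: int
  shows "tri (3*i) + (9*i^2+3*i) = (27*i^2+3*i) div 2"
    "tri (3*i+2) + (9*i^2+3*i) = (27*i^2+15*i+2) div 2"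
proof -
  have "2 * (tri (3*i) + (9*i^2+3*i)) = 27*i^2+3*i"
    using two_tri[of "3*i"] by (simp add: power2_eq_square algebra_simps)
  thus "tri (3*i) + (9*i^2+3*i) = (27*i^2+3*i) div 2" by simp
  have "2 * (tri (3*i+2) + (9*i^2+3*i)) = 27*i^2+15*i+2"
    using two_tri[of "3*i+2"] by (simp add: power2_eq_square algebra_simps)
  thus "tri (3*i+2) + (9*i^2+3*i) = (27*i^2+15*i+2) div 2" by simp
qed

lemma generic_power:
  assumes "generic q" "0 < n"
  shows "generic (q ^ n)"
  using assms by (simp add: generic_def flip: power_mult)

lemma generic_inj:
  fixes q :: "'a::field"
  assumes q: "generic q" and e: "q ^ a = q ^ b"
  shows "a = b"
proof -
  have *: "a = b" if "q ^ a = q ^ b" "a \<le> b" for a b :: nat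
  proof (rule ccontr)
    assume "a \<noteq> b"
    hence "q ^ (b - a) \<noteq> 1" using genericD(2)[OF q, of "b - a"] that by simp
    moreover have "q ^ b = q ^ a * q ^ (b - a)" using that(2) by (simp flip: power_add)
    ultimately show False using that genericD(1)[OF q] by simp
  qed
  show ?thesis using *[of a b] *[of b a] e by (cases "a \<le> b") auto
qed

text \<open>The finite quintuple product identity in base \<open>x^9\<close> with \<open>N = 2L\<close> and argument \<open>- x / (x^9)^L\<close>; shifting
  the summation index by \<open>L\<close> makes the sum symmetric. As \<open>L\<close> grows, it becomes
  \<open>\<Theta> = (x^9; x^9) (x^2; x^9) (x^7; x^9) / ((-x; x^9) (-x^8; x^9))\<close> with infinite q-Pochhammer symbols.\<close>

lemma quintuple_mod9_finite:
  fixes x :: "'a::field"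
  assumes x: "generic x"
  shows "(\<Sum>k\<le>2*L. (x powi ((27*(int k - int L)^2 - 3*(int k - int L)) div 2)
                   - x powi ((27*(int k - int L)^2 + 15*(int k - int L) + 2) div 2))
            * rqfact (x^9) (int k) * rqfact (x^9) (int (2*L) - int k)
            * inverse (qpoch (x^7) (x^9) (2*L - k)) * inverse (qpoch (x^2) (x^9) (Suc k)))
       = rqfact (x^9) (int (2*L)) * inverse (qpoch (- (x^8)) (x^9) L) * inverse (qpoch (- x) (x^9) (Suc L))"
proof -
  define q where "q = x ^ 9"
  define z where "z = - x / q ^ L"
  have q: "generic q" unfolding q_def by (rule generic_power[OF x]) simp
  note x0 = genericD(1)[OF x] and q0 = genericD(1)[OF q]
  have z: "z^2 * q ^ i \<noteq> 1" for i
  proof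
    assume "z^2 * q ^ i = 1"
    hence "x ^ (2 + 9*i) = x ^ (18 * L)"
      using x0 by (simp add: z_def q_def field_simps flip: power_mult power_add)
    hence "2 + 9*i = 18 * L" by (rule generic_inj[OF x])
    hence "(2 + 9*i) mod 9 = (18 * L) mod 9" by simp
    thus False by presburger
  qed
  define A where "A = x ^ L * q powi (- tri (int L + 1))"
  have A: "qpoch z q (Suc (2*L)) = A * qpoch (- (x^8)) q L * qpoch (- x) q (Suc L)"
  proof -
    have "Suc (2*L) = L + Suc L" by simp
    moreover have "q / (- x) = - (x^8)" using x0 by (simp add: q_def field_simps flip: power_Suc)
    moreover have "z * q ^ L = - x" using q0 by (simp add: z_def)
    moreover have "qpoch z q L = A * qpoch (q / (- x)) q L"
      unfolding z_def A_def by (subst qpoch_reverse) (use x0 q0 in simp_all)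
    ultimately show ?thesis by (simp only: qpoch_add)
  qed
  have A0: "A \<noteq> 0" using x0 q0 by (simp add: A_def)
  have key: "A * ((1 + z * q ^ k) * z ^ k * q ^ (k^2) * rqfact q (int k) * rqfact q (int (2*L) - int k)
            * inverse (qpoch (z^2 * q ^ k) q (Suc (2*L))))
      = (x powi ((27*(int k - int L)^2 - 3*(int k - int L)) div 2)
                   - x powi ((27*(int k - int L)^2 + 15*(int k - int L) + 2) div 2))
            * rqfact q (int k) * rqfact q (int (2*L) - int k)
            * inverse (qpoch (x^7) q (2*L - k)) * inverse (qpoch (x^2) q (Suc k))"
    if "k \<le> 2*L" for k
  proof -
    define j where "j = 2*L - k"
    have j: "2*L = j + k" using that by (simp add: j_def)
    define B where "B = (- (x^2)) ^ j * q powi (- tri (int j + 1))"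
    have zq: "z^2 * q ^ k = x^2 / q ^ j"
    proof -
      have "z^2 = x^2 / q ^ (2*L)"
        by (simp add: z_def power_divide power_mult[symmetric] mult.commute)
      thus ?thesis using q0 unfolding j by (simp add: power_add)
    qed
    have "q / x^2 = x^7" using x0 by (simp add: q_def field_simps flip: power_add)
    have B: "qpoch (z^2 * q ^ k) q (Suc (2*L)) = B * qpoch (x^7) q j * qpoch (x^2) q (Suc k)"
    proof -
      have "Suc (2*L) = j + Suc k" using j by simp
      moreover have "x^2 / q ^ j * q ^ j = x^2" using q0 by simp
      moreover have "qpoch (x^2 / q ^ j) q j = B * qpoch (q / x^2) q j"
        unfolding B_def by (subst qpoch_reverse) (use x0 q0 in simp_all)
      ultimately show ?thesis unfolding zq by (simp only: qpoch_add \<open>q / x^2 = x^7\<close>)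
    qed
    define i where "i = int k - int L"
    define e where "e = (27*i^2 - 3*i) div 2"
    \<comment> \<open>The left side collects the powers of x coming from A, z^k, q^(k^2) and 1/B.\<close>
    have e: "int L - 9 * tri (int L + 1) + int k * (1 - 9 * int L) + 9 * (int k)^2 - 2 * int j + 9 * tri (int j + 1) = e"
    proof -
      have j': "int j = 2 * int L - int k" using j by simp
      have "2 * (int L - 9 * tri (int L + 1) + int k * (1 - 9 * int L) + 9 * (int k)^2 - 2 * int j + 9 * tri (int j + 1))
          = 2 * int L - 9 * (2 * tri (int L + 1)) + 2 * (int k * (1 - 9 * int L)) + 18 * (int k)^2 - 4 * int j + 9 * (2 * tri (int j + 1))"
        by simp
      also have "\<dots> = 27*i^2 - 3*i"
        unfolding two_tri j' i_def by (simp add: power2_eq_square algebra_simps)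
      finally have "2 * (int L - 9 * tri (int L + 1) + int k * (1 - 9 * int L) + 9 * (int k)^2 - 2 * int j + 9 * tri (int j + 1)) = 27*i^2 - 3*i" .
      thus ?thesis by (simp add: e_def)
    qed
    have e': "(27*i^2 + 15*i + 2) div 2 = e + (1 + 9*i)"
    proof -
      have "27*i^2 + 15*i + 2 = (27*i^2 - 3*i) + (1 + 9*i) * 2" by simp
      thus ?thesis unfolding e_def by (simp only: div_mult_self1 zero_neq_numeral not_False_eq_True)
    qed
    have qp: "q powi a = x powi (9 * a)" for a
      by (simp add: q_def power_int_power)
    have z1: "z * q ^ k = - (x powi (1 + 9*i))"
      using x0 unfolding z_def i_def power_int_of_nat[symmetric] qp
      by (simp add: power_int_add power_int_diff algebra_simps)
    have z2: "z ^ k = (-1) ^ k * x powi (int k * (1 - 9 * int L))"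
    proof -
      have "z = (-1) * x powi (1 - 9 * int L)"
        using x0 unfolding z_def power_int_of_nat[symmetric] qp by (simp add: power_int_diff)
      hence "z ^ k = (-1) ^ k * (x powi (1 - 9 * int L)) ^ k" by (simp only: power_mult_distrib)
      thus ?thesis by (simp only: power_int_power' mult.commute)
    qed
    have B': "inverse B = (-1) ^ j * x powi (- 2 * int j + 9 * tri (int j + 1))"
    proof -
      have "(- (x^2)) ^ j = (-1) ^ j * x powi (2 * int j)"
        by (subst power_minus) (simp add: power_int_mult power_mult)
      thus ?thesis using x0 unfolding B_def qp
        by (simp add: power_int_add power_int_minus power_int_diff field_simps flip: power_mult_distrib)
    qed
    have "(-1) ^ k * (-1) ^ j = (1::'a)"
      using j by (metis add.commute power_add power_mult power2_minus one_power2 power_one)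
    moreover have "A = x powi (int L - 9 * tri (int L + 1))"
      using x0 unfolding A_def qp by (simp add: power_int_diff power_int_minus field_simps)
    moreover have "q ^ (k^2) = x powi (9 * (int k)^2)"
      using qp[of "int (k^2)"] unfolding power_int_of_nat by simp
    moreover have "x powi (int L - 9 * tri (int L + 1)) * x powi (int k * (1 - 9 * int L)) * x powi (9 * (int k)^2)
        * x powi (- 2 * int j + 9 * tri (int j + 1)) = x powi e"
      unfolding e[symmetric] using x0 by (subst power_int_add[symmetric], simp)+ (simp add: algebra_simps)
    moreover have "a * (s * b) * c * (t * d) = (s * t) * (a * b * c * d)" for a b c d s t :: 'a
      by (simp only: mult_ac)
    ultimately have "A * z ^ k * q ^ (k^2) * inverse B = x powi e"
      unfolding z2 B' by (simp only: mult_1)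
    hence "A * ((1 + z * q ^ k) * z ^ k * q ^ (k^2)) * inverse B = x powi e - x powi (e + (1 + 9*i))"
      unfolding z1 using x0 by (simp add: power_int_add algebra_simps)
    thus ?thesis
      unfolding B e_def[symmetric] i_def[symmetric] e' j_def[symmetric]
      by (simp add: mult_ac)
  qed
  have main: "A * (\<Sum>k\<le>2*L. (1 + z * q ^ k) * z ^ k * q ^ (k^2) * rqfact q (int k) * rqfact q (int (2*L) - int k)
            * inverse (qpoch (z^2 * q ^ k) q (Suc (2*L))))
      = rqfact q (int (2*L)) * inverse (qpoch (- (x^8)) q L) * inverse (qpoch (- x) q (Suc L))"
    unfolding quintuple_finite[OF q z] A using A0 by (simp add: mult_ac)
  show ?thesis
    unfolding q_def[symmetric]
    by (rule trans[OF _ main], unfold sum_distrib_left, intro sum.cong refl key[symmetric]) simp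
qed

section \<open>Passing to the limit in formal power series\<close>

text \<open>Congruence modulo \<open>X^N\<close>.\<close>

definition agree :: "nat \<Rightarrow> rat fps \<Rightarrow> rat fps \<Rightarrow> bool" where
  "agree N f g \<longleftrightarrow> (\<forall>i<N. fps_nth f i = fps_nth g i)"

lemma agree_refl [simp]: "agree N f f"
  by (simp add: agree_def)

lemma agree_sym: "agree N f g \<Longrightarrow> agree N g f"
  by (simp add: agree_def)

lemma agree_trans [trans]: "agree N f g \<Longrightarrow> agree N g h \<Longrightarrow> agree N f h"
  by (simp add: agree_def)

lemma agree_add: "agree N f f' \<Longrightarrow> agree N g g' \<Longrightarrow> agree N (f + g) (f' + g')"
  by (simp add: agree_def)

lemma agree_diff: "agree N f f' \<Longrightarrow> agree N g g' \<Longrightarrow> agree N (f - g) (f' - g')"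
  by (simp add: agree_def)

lemma agree_mult: "agree N f f' \<Longrightarrow> agree N g g' \<Longrightarrow> agree N (f * g) (f' * g')"
  unfolding agree_def fps_mult_nth by (intro allI impI sum.cong) auto

lemma agree_sum: "(\<And>i. i \<in> A \<Longrightarrow> agree N (f i) (g i)) \<Longrightarrow> agree N (sum f A) (sum g A)"
  unfolding agree_def fps_sum_nth by (intro allI impI sum.cong) auto

lemma agree_prod: "(\<And>i. i \<in> A \<Longrightarrow> agree N (f i) (g i)) \<Longrightarrow> agree N (prod f A) (prod g A)"
  by (induction A rule: infinite_finite_induct) (auto intro!: agree_mult)

lemma agree_cancel:
  assumes "agree N (f * u) (g * u)" "fps_nth u 0 \<noteq> 0"
  shows "agree N f g"
proof -
  have "agree N (f * u * inverse u) (g * u * inverse u)"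
    by (rule agree_mult[OF assms(1) agree_refl])
  thus ?thesis using assms(2) by (simp add: mult.assoc inverse_mult_eq_1')
qed

lemma agree_inverse:
  assumes "agree N f g" "fps_nth f 0 \<noteq> 0" "fps_nth g 0 \<noteq> 0"
  shows "agree N (inverse f) (inverse g)"
proof (rule agree_cancel[of _ _ "f * g"])
  have "inverse f * (f * g) = g" "inverse g * (f * g) = f"
    using assms inverse_mult_eq_1[of f] inverse_mult_eq_1[of g]
    by (metis mult.assoc mult.commute mult_1)+
  thus "agree N (inverse f * (f * g)) (inverse g * (f * g))"
    using agree_sym[OF assms(1)] by (simp only:)
qed (use assms in simp)

lemma agree_X_power: "N \<le> a \<Longrightarrow> agree N (fps_X ^ a) 0"
  by (simp add: agree_def)

lemma agree_X_power_mult: "N \<le> a \<Longrightarrow> agree N (fps_X ^ a * f) 0"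
  by (simp add: agree_def fps_X_power_mult_nth)

lemma agree_prod_superset:
  assumes "finite B" "A \<subseteq> B" "\<And>i. i \<in> B - A \<Longrightarrow> agree N (f i) 1"
  shows "agree N (prod f B) (prod f A)"
proof -
  have "agree N (prod f (B - A)) (\<Prod>i\<in>B-A. 1)" by (rule agree_prod) (rule assms(3))
  hence "agree N (prod f (B - A) * prod f A) (1 * prod f A)" by (intro agree_mult) auto
  moreover have "prod f B = prod f (B - A) * prod f A"
    using assms by (simp add: prod.subset_diff)
  ultimately show ?thesis by simp
qed

lemma agree_sum_superset:
  assumes "finite B" "A \<subseteq> B" "\<And>i. i \<in> B - A \<Longrightarrow> agree N (f i) 0"
  shows "agree N (sum f B) (sum f A)"
proof -
  have "agree N (sum f (B - A)) (\<Sum>i\<in>B-A. 0)" by (rule agree_sum) (rule assms(3))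
  hence "agree N (sum f (B - A) + sum f A) (0 + sum f A)" by (intro agree_add) auto
  moreover have "sum f B = sum f (B - A) + sum f A"
    using assms by (simp add: sum.subset_diff)
  ultimately show ?thesis by simp
qed

lemma fps_nth_prod_0: "fps_nth (prod f A) 0 = (\<Prod>i\<in>A. fps_nth (f i) 0)"
  by (induction A rule: infinite_finite_induct) auto

lemma qfact_nth_0: "0 < c \<Longrightarrow> fps_nth (qfact (fps_X ^ c :: rat fps) n) 0 = 1"
  by (auto simp: qfact_def fps_nth_prod_0 simp flip: power_mult intro!: prod.neutral)

lemma qpoch_nth_0: "fps_nth z 0 = 0 \<Longrightarrow> fps_nth (qpoch (z :: rat fps) q n) 0 = 1"
  by (auto simp: qpoch_def fps_nth_prod_0 intro!: prod.neutral)

lemma agree_qpoch: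
  assumes "N \<le> a" "N \<le> b" "0 < c"
  shows "agree N (qpoch z (fps_X ^ c) a) (qpoch z (fps_X ^ c) b)"
proof -
  have *: "agree N (qpoch z (fps_X ^ c) a) (qpoch z (fps_X ^ c) N)" if "N \<le> a" for a
    unfolding qpoch_def
  proof (rule agree_prod_superset)
    fix i assume "i \<in> {..<a} - {..<N}"
    hence "N \<le> c * i" using assms(3) by (metis DiffE lessThan_iff mult_le_mono1 mult_1 not_less le_trans Suc_leI One_nat_def)
    hence "agree N (1 - z * (fps_X ^ c) ^ i) (1 - z * 0)"
      by (intro agree_diff agree_mult) (auto simp flip: power_mult intro: agree_X_power)
    thus "agree N (1 - z * (fps_X ^ c) ^ i) 1" by simp
  qed (use that in auto)
  show ?thesis using *[OF assms(1)] *[OF assms(2)] agree_sym agree_trans by blast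
qed

lemma agree_rqfact:
  assumes "int N \<le> a" "int N \<le> b" "0 < c"
  shows "agree N (rqfact (fps_X ^ c) a) (rqfact (fps_X ^ c) b)"
proof -
  have *: "agree N (qfact (fps_X ^ c) (nat a)) (qfact (fps_X ^ c) N)" if "int N \<le> a" for a
    unfolding qfact_def
  proof (rule agree_prod_superset)
    fix i assume "i \<in> {1..nat a} - {1..N}"
    hence "N \<le> i" by auto
    also have "i \<le> c * i" using assms(3) by simp
    finally have "N \<le> c * i" .
    hence "agree N (1 - (fps_X ^ c) ^ i) (1 - 0)"
      by (intro agree_diff) (auto simp flip: power_mult intro: agree_X_power)
    thus "agree N (1 - (fps_X ^ c) ^ i) 1" by simp
  qed (use that in auto)
  have "agree N (rqfact (fps_X ^ c) a) (inverse (qfact (fps_X ^ c) N))" if "int N \<le> a" for a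
    using that qfact_nth_0[OF assms(3)]
    by (auto simp: rqfact_def intro!: agree_inverse *)
  from this[OF assms(1)] this[OF assms(2)] show ?thesis using agree_sym agree_trans by blast
qed

lemma fps_to_fls_prod: "fps_to_fls (prod f A) = (\<Prod>i\<in>A. fps_to_fls (f i :: rat fps))"
  by (induction A rule: infinite_finite_induct) (auto simp: fls_times_fps_to_fls)

lemma fps_to_fls_sum: "fps_to_fls (sum f A) = (\<Sum>i\<in>A. fps_to_fls (f i :: rat fps))"
  by (induction A rule: infinite_finite_induct) auto

lemma fps_to_fls_inverse: "fps_nth f 0 \<noteq> 0 \<Longrightarrow> fps_to_fls (inverse f) = inverse (fps_to_fls (f :: rat fps))"
proof -
  assume "fps_nth f 0 \<noteq> 0"
  hence "fps_to_fls (inverse f) * fps_to_fls f = 1"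
    by (simp flip: fls_times_fps_to_fls add: inverse_mult_eq_1)
  thus ?thesis by (metis inverse_unique mult.commute)
qed

lemma generic_fls_X: "generic (fls_X :: rat fls)"
proof -
  have "(fls_X :: rat fls) ^ k \<noteq> 1" if "0 < k" for k
  proof
    assume "(fls_X :: rat fls) ^ k = 1"
    hence "fls_nth ((fls_X :: rat fls) ^ k) 0 = fls_nth 1 0" by (simp only:)
    thus False using that unfolding fls_X_power_nth by simp
  qed
  thus ?thesis by (simp add: generic_def)
qed

lemma fps_to_fls_qfact: "fps_to_fls (qfact (q :: rat fps) n) = qfact (fps_to_fls q) n"
  by (simp add: qfact_def fps_to_fls_prod fps_to_fls_power)

lemma fps_to_fls_qpoch: "fps_to_fls (qpoch (z :: rat fps) q n) = qpoch (fps_to_fls z) (fps_to_fls q) n"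
  by (simp add: qpoch_def fps_to_fls_prod fps_to_fls_power fls_times_fps_to_fls)

lemma fps_to_fls_phi6_prod: "fps_to_fls (phi6_prod (q :: rat fps) n) = phi6_prod (fps_to_fls q) n"
  by (simp add: phi6_prod_def fps_to_fls_prod fps_to_fls_power fls_times_fps_to_fls)

lemma fps_to_fls_rqfact: "0 < c \<Longrightarrow> fps_to_fls (rqfact (fps_X ^ c :: rat fps) k) = rqfact (fls_X ^ c) k"
  by (simp add: rqfact_def fps_to_fls_inverse qfact_nth_0 fps_to_fls_qfact fps_to_fls_power)

text \<open>The series \<open>\<Theta>\<close>, cut off where it no longer contributes modulo \<open>X^N\<close>.\<close>

definition theta :: "nat \<Rightarrow> rat fps" where
  "theta N = (\<Sum>k=-int N..int N. fps_X ^ nat ((27*k^2+3*k) div 2) - fps_X ^ nat ((27*k^2+15*k+2) div 2))"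

lemma theta_exponent_bounds:
  fixes k :: int
  shows "\<bar>k\<bar> \<le> (27*k^2+3*k) div 2" "\<bar>k\<bar> \<le> (27*k^2-3*k) div 2" "\<bar>k\<bar> \<le> (27*k^2+15*k+2) div 2"
proof -
  have sq: "\<bar>k\<bar> \<le> k^2"
  proof (cases "k = 0")
    case False
    hence "1 \<le> \<bar>k\<bar>" by linarith
    from self_le_power[OF this, of 2] show ?thesis by simp
  qed simp
  show "\<bar>k\<bar> \<le> (27*k^2+3*k) div 2" "\<bar>k\<bar> \<le> (27*k^2-3*k) div 2" "\<bar>k\<bar> \<le> (27*k^2+15*k+2) div 2"
    using sq by linarith+
qed

lemma fls_X_powi:
  fixes k :: int
  shows "(fls_X :: rat fls) powi ((27*k^2+3*k) div 2) = fls_X ^ nat ((27*k^2+3*k) div 2)"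
    "(fls_X :: rat fls) powi ((27*k^2-3*k) div 2) = fls_X ^ nat ((27*k^2-3*k) div 2)"
    "(fls_X :: rat fls) powi ((27*k^2+15*k+2) div 2) = fls_X ^ nat ((27*k^2+15*k+2) div 2)"
  by (rule power_int_nonneg_exp, rule order_trans[OF abs_ge_zero theta_exponent_bounds(1)],
      rule power_int_nonneg_exp, rule order_trans[OF abs_ge_zero theta_exponent_bounds(2)],
      rule power_int_nonneg_exp, rule order_trans[OF abs_ge_zero theta_exponent_bounds(3)])

lemma bailey_sum_fps:
  assumes "M < L"
  shows "(\<Sum>m\<le>M. fps_X ^ (m^2+m) * phi6_prod fps_X m * rqfact fps_X (2 * int m) * rqfact fps_X (int M - int m))
     = (\<Sum>k=-int L..int L. (fps_X ^ nat ((27*k^2+3*k) div 2) - fps_X ^ nat ((27*k^2+15*k+2) div 2))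
          * rqfact fps_X (int M - 3*k) * rqfact (fps_X :: rat fps) (int M + 3*k + 1))" (is "?l = ?r")
proof -
  have iq: "fps_to_fls (rqfact (fps_X :: rat fps) k) = rqfact fls_X k" for k
    using fps_to_fls_rqfact[of 1 k] by simp
  have two: "(2 :: rat fls) \<noteq> 0"
    by simp
  have "fps_to_fls ?l = fps_to_fls ?r"
    using bailey_sum_finite[OF generic_fls_X two, of M "int L"] assms
    unfolding bailey_exponents fls_X_powi
    by (simp only: fps_to_fls_sum fls_times_fps_to_fls iq fps_to_fls_phi6_prod fps_to_fls_power fps_X_to_fls fps_to_fls_minus of_nat_less_iff)
  thus ?thesis by (simp only: fps_to_fls_eq_iff)
qed

lemma quintuple_mod9_fps:
  shows "(\<Sum>k=-int L..int L. (fps_X ^ nat ((27*k^2-3*k) div 2) - fps_X ^ nat ((27*k^2+15*k+2) div 2))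
            * rqfact (fps_X^9) (int L + k) * rqfact (fps_X^9) (int L - k)
            * inverse (qpoch (fps_X^7) (fps_X^9) (nat (int L - k))) * inverse (qpoch (fps_X^2) (fps_X^9) (nat (int L + k + 1))))
       = rqfact (fps_X^9) (int (2*L)) * inverse (qpoch (- (fps_X^8)) (fps_X^9) L) 
          * inverse (qpoch (- fps_X) (fps_X^9 :: rat fps) (Suc L))" (is "?l = ?r")
proof -
  have iq: "fps_to_fls (rqfact (fps_X ^ 9 :: rat fps) k) = rqfact (fls_X ^ 9) k" for k
    by (rule fps_to_fls_rqfact) simp
  have nz: "fps_nth (qpoch (fps_X^7) (fps_X^9 :: rat fps) n) 0 \<noteq> 0" "fps_nth (qpoch (fps_X^2) (fps_X^9 :: rat fps) n) 0 \<noteq> 0"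
    "fps_nth (qpoch (-(fps_X^8)) (fps_X^9 :: rat fps) n) 0 \<noteq> 0" "fps_nth (qpoch (-fps_X) (fps_X^9 :: rat fps) n) 0 \<noteq> 0" for n
    by (simp_all add: qpoch_nth_0)
  have "fps_to_fls ?l = (\<Sum>k\<le>2*L. (fls_X powi ((27*(int k - int L)^2 - 3*(int k - int L)) div 2)
                   - fls_X powi ((27*(int k - int L)^2 + 15*(int k - int L) + 2) div 2))
            * rqfact (fls_X^9) (int k) * rqfact (fls_X^9) (int (2*L) - int k)
            * inverse (qpoch (fls_X^7) (fls_X^9) (2*L - k)) * inverse (qpoch (fls_X^2) (fls_X^9) (Suc k)))"
    unfolding fps_to_fls_sum
  proof (rule sum.reindex_bij_witness[of _ "\<lambda>k. int k - int L" "\<lambda>k. nat (k + int L)"])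
    fix k :: int assume k: "k \<in> {-int L..int L}"
    have n: "int (nat (k + int L)) = int L + k" "nat (int L - k) = 2*L - nat (k + int L)"
      "nat (int L + k + 1) = Suc (nat (k + int L))" "int (2*L) - int (nat (k + int L)) = int L - k"
      "int (nat (k + int L)) - int L = k"
      using k by auto
    show "(fls_X powi ((27*(int (nat (k + int L)) - int L)^2 - 3*(int (nat (k + int L)) - int L)) div 2)
                   - fls_X powi ((27*(int (nat (k + int L)) - int L)^2 + 15*(int (nat (k + int L)) - int L) + 2) div 2))
            * rqfact (fls_X^9) (int (nat (k + int L))) * rqfact (fls_X^9) (int (2*L) - int (nat (k + int L)))
            * inverse (qpoch (fls_X^7) (fls_X^9) (2*L - (nat (k + int L)))) * inverse (qpoch (fls_X^2) (fls_X^9) (Suc (nat (k + int L))))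
      = fps_to_fls ((fps_X ^ nat ((27*k^2-3*k) div 2) - fps_X ^ nat ((27*k^2+15*k+2) div 2))
            * rqfact (fps_X^9) (int L + k) * rqfact (fps_X^9) (int L - k)
            * inverse (qpoch (fps_X^7) (fps_X^9) (nat (int L - k))) * inverse (qpoch (fps_X^2) (fps_X^9 :: rat fps) (nat (int L + k + 1))))"
      unfolding n(4,5) unfolding n(1) unfolding n(2)[symmetric] n(3)[symmetric] fls_X_powi
      by (simp only: fls_times_fps_to_fls iq fps_to_fls_inverse[OF nz(1)] fps_to_fls_inverse[OF nz(2)] fps_to_fls_qpoch fps_to_fls_power fps_X_to_fls fps_to_fls_minus)
  qed auto
  also have "\<dots> = fps_to_fls ?r"
    unfolding quintuple_mod9_finite[OF generic_fls_X]
    by (simp only: fls_times_fps_to_fls iq fps_to_fls_inverse[OF nz(3)] fps_to_fls_inverse[OF nz(4)] fps_to_fls_qpoch fps_to_fls_power fps_to_fls_uminus fps_X_to_fls)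
  finally show ?thesis by (simp only: fps_to_fls_eq_iff)
qed

text \<open>Terms with \<open>|k| \<ge> N\<close> vanish modulo \<open>X^N\<close>, so a weight that is constant modulo \<open>X^N\<close> on the remaining terms
  can be taken out of the sum. This is the passage to the limit in both finite identities.\<close>

lemma agree_theta_sum:
  assumes "N \<le> L"
    and w: "\<And>k. \<bar>k\<bar> < int N \<Longrightarrow> agree N (w k) W"
    and e: "\<And>k. \<bar>k\<bar> \<le> e k"
  shows "agree N (\<Sum>k=-int L..int L. (fps_X ^ nat (e k) - fps_X ^ nat ((27*k^2+15*k+2) div 2)) * w k)
     ((\<Sum>k=-int N..int N. fps_X ^ nat (e k) - fps_X ^ nat ((27*k^2+15*k+2) div 2)) * W)"
proof -
  let ?e = "\<lambda>k. fps_X ^ nat (e k) - fps_X ^ nat ((27*k^2+15*k+2) div 2) :: rat fps"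
  have z: "agree N (?e k) 0" if "int N \<le> \<bar>k\<bar>" for k
  proof -
    have "agree N (?e k) (0 - 0)"
      using that e[of k] theta_exponent_bounds(3)[of k] by (intro agree_diff agree_X_power) linarith+
    thus ?thesis by simp
  qed
  have t: "agree N (?e k * w k) (?e k * W)" for k
  proof (cases "\<bar>k\<bar> < int N")
    case True
    thus ?thesis by (intro agree_mult w) auto
  next
    case False
    hence "agree N (?e k) 0" by (intro z) simp
    from agree_mult[OF this agree_refl] have "agree N (?e k * u) 0" for u by (metis mult_zero_left)
    thus ?thesis using agree_sym agree_trans by blast
  qed
  have "agree N (\<Sum>k=-int L..int L. ?e k * w k) (\<Sum>k=-int L..int L. ?e k * W)"
    by (intro agree_sum t)
  also have "agree N (\<Sum>k=-int L..int L. ?e k * W) (\<Sum>k=-int N..int N. ?e k * W)"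
  proof (rule agree_sum_superset)
    fix k assume "k \<in> {-int L..int L} - {-int N..int N}"
    hence "int N \<le> \<bar>k\<bar>" by auto
    hence "agree N (?e k * W) (0 * W)" by (intro agree_mult z) auto
    thus "agree N (?e k * W) 0" by simp
  qed (use assms(1) in auto)
  finally show ?thesis by (simp only: sum_distrib_right)
qed

text \<open>The limit of \<open>bailey_sum_fps\<close>. Its two sides involve one and two factors \<open>1/Q(\<infinity>)\<close>, of which one cancels.\<close>

lemma agree_bailey:
  "agree N (\<Sum>m<N. fps_X ^ (m^2+m) * phi6_prod fps_X m * rqfact fps_X (2 * int m)) (theta N * rqfact fps_X (int N))"
proof (rule agree_cancel)
  define I where "I = rqfact (fps_X :: rat fps) (int N)"
  \<comment> \<open>For |k| < N the arguments M - 3k and M + 3k + 1 both remain at least N, as does M - m for m < N.\<close>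
  define M where "M = 5 * N"
  let ?c = "\<lambda>m. fps_X ^ (m^2+m) * phi6_prod fps_X m * rqfact fps_X (2 * int m) :: rat fps"
  have iq: "agree N (rqfact fps_X a) I" if "int N \<le> a" for a
    using agree_rqfact[of N a "int N" 1] that by (simp add: I_def)
  have t: "agree N (?c m * rqfact fps_X (int M - int m)) (?c m * I)" for m
  proof (cases "m < N")
    case True
    thus ?thesis by (intro agree_mult iq) (auto simp: M_def)
  next
    case False
    have "m \<le> m^2+m" by simp
    hence "N \<le> m^2+m" using False by linarith
    hence z: "agree N (?c m * u) 0" for u
      unfolding mult.assoc by (rule agree_X_power_mult)
    show ?thesis by (rule agree_trans[OF z agree_sym[OF z]])
  qed
  have "agree N ((\<Sum>m<N. ?c m) * I) (\<Sum>m<N. ?c m * rqfact fps_X (int M - int m))"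
    unfolding sum_distrib_right by (intro agree_sum agree_sym[OF t])
  also have "agree N \<dots> (\<Sum>m\<le>M. ?c m * rqfact fps_X (int M - int m))"
  proof (rule agree_sym, rule agree_sum_superset)
    fix m assume "m \<in> {..M} - {..<N}"
    moreover have "m \<le> m^2+m" by simp
    ultimately have "N \<le> m^2+m" by auto
    thus "agree N (?c m * rqfact fps_X (int M - int m)) 0"
      unfolding mult.assoc by (rule agree_X_power_mult)
  qed (auto simp: M_def)
  also have "\<dots> = (\<Sum>k=-int (Suc M)..int (Suc M). (fps_X ^ nat ((27*k^2+3*k) div 2) - fps_X ^ nat ((27*k^2+15*k+2) div 2))
          * (rqfact fps_X (int M - 3*k) * rqfact fps_X (int M + 3*k + 1)))"
    unfolding mult.assoc[symmetric] by (rule bailey_sum_fps) simp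
  also have "agree N \<dots> (theta N * (I * I))"
    unfolding theta_def by (rule agree_theta_sum) (auto simp: M_def intro!: agree_mult iq theta_exponent_bounds)
  finally show "agree N ((\<Sum>m<N. ?c m) * I) (theta N * rqfact fps_X (int N) * I)"
    by (simp add: I_def mult.assoc)
  show "fps_nth I 0 \<noteq> 0" 
    using qfact_nth_0[of 1 N] by (simp add: I_def rqfact_def)
qed

text \<open>The limit of \<open>quintuple_mod9_fps\<close>, cleared of denominators. The bound \<open>2N\<close> rather than \<open>N\<close> lets the
  products be split by residues modulo \<open>18\<close>. The reflection \<open>k \<mapsto> -k\<close> of the first exponent
  identifies the sum with \<open>theta\<close>.\<close>

lemma agree_quintuple:
  "agree N (theta N * qpoch (- (fps_X^8)) (fps_X^9) (2*N) * qpoch (- fps_X) (fps_X^9) (2*N))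
     (qfact (fps_X^9) (2*N) * qpoch (fps_X^7) (fps_X^9) (2*N) * qpoch (fps_X^2) (fps_X^9) (2*N))"
proof -
  define J where "J = rqfact (fps_X ^ 9 :: rat fps) (int (2*N))"
  define P where "P = (\<lambda>z. qpoch z (fps_X ^ 9 :: rat fps) (2*N))"
  define L where "L = 3 * N"
  have iq: "agree N (rqfact (fps_X^9) a) J" if "int N \<le> a" for a
    unfolding J_def by (rule agree_rqfact) (use that in auto)
  have P: "agree N (inverse (qpoch z (fps_X ^ 9) a)) (inverse (P z))" if "N \<le> a" "fps_nth z 0 = 0" for a z
    unfolding P_def by (intro agree_inverse agree_qpoch) (use that in \<open>auto simp: qpoch_nth_0\<close>)
  have th: "theta N = (\<Sum>k=-int N..int N. fps_X ^ nat ((27*k^2-3*k) div 2) - fps_X ^ nat ((27*k^2+15*k+2) div 2))"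
    using sum_int_reflect[of "\<lambda>k. fps_X ^ nat ((27*k^2+3*k) div 2) :: rat fps" "int N"]
    by (simp add: theta_def sum_subtractf)
  have "agree N (theta N * (J * (J * (inverse (P (fps_X^7)) * inverse (P (fps_X^2))))))
    (\<Sum>k=-int L..int L. (fps_X ^ nat ((27*k^2-3*k) div 2) - fps_X ^ nat ((27*k^2+15*k+2) div 2))
            * (rqfact (fps_X^9) (int L + k) * (rqfact (fps_X^9) (int L - k)
            * (inverse (qpoch (fps_X^7) (fps_X^9) (nat (int L - k))) * inverse (qpoch (fps_X^2) (fps_X^9) (nat (int L + k + 1)))))))"
    unfolding th
    by (rule agree_sym, rule agree_theta_sum) (auto simp: L_def intro!: agree_mult iq P theta_exponent_bounds)
  also have "\<dots> = rqfact (fps_X^9) (int (2*L)) * inverse (qpoch (- (fps_X^8)) (fps_X^9) L) 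
          * inverse (qpoch (- fps_X) (fps_X^9 :: rat fps) (Suc L))"
    unfolding quintuple_mod9_fps[symmetric] by (simp only: mult.assoc)
  also have "agree N \<dots> (J * inverse (P (-(fps_X^8))) * inverse (P (-fps_X)))"
    by (intro agree_mult iq P) (auto simp: L_def)
  finally have *: "agree N (theta N * (J * (J * (inverse (P (fps_X^7)) * inverse (P (fps_X^2))))))
    (J * inverse (P (-(fps_X^8))) * inverse (P (-fps_X)))" .
  have cJ: "J * qfact (fps_X^9) (2*N) = 1"
    by (simp add: J_def rqfact_def inverse_mult_eq_1 qfact_nth_0 del: of_nat_mult)
  have cP: "inverse (P z) * P z = 1" if "fps_nth z 0 = 0" for z
    using that by (simp add: P_def inverse_mult_eq_1 qpoch_nth_0)
  let ?P2 = "P (fps_X^2)" and ?P7 = "P (fps_X^7)" and ?P8 = "P (-(fps_X^8))" and ?P1 = "P (-fps_X)"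
    and ?Q = "qfact (fps_X^9 :: rat fps) (2*N)"
  have "agree N (theta N * (J * (J * (inverse ?P7 * inverse ?P2))) * (?Q * ?Q * ?P2 * ?P7 * ?P8 * ?P1))
     (J * inverse ?P8 * inverse ?P1 * (?Q * ?Q * ?P2 * ?P7 * ?P8 * ?P1))"
    by (rule agree_mult[OF * agree_refl])
  also have "theta N * (J * (J * (inverse ?P7 * inverse ?P2))) * (?Q * ?Q * ?P2 * ?P7 * ?P8 * ?P1)
    = theta N * ?P8 * ?P1 * (J * ?Q) * (J * ?Q) * (inverse ?P7 * ?P7) * (inverse ?P2 * ?P2)"
    by (simp only: mult_ac)
  also have "J * inverse ?P8 * inverse ?P1 * (?Q * ?Q * ?P2 * ?P7 * ?P8 * ?P1)
    = ?Q * ?P7 * ?P2 * (J * ?Q) * (inverse ?P8 * ?P8) * (inverse ?P1 * ?P1)"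
    by (simp only: mult_ac)
  finally show ?thesis by (simp add: cJ cP) (simp add: P_def)
qed

definition residue_prod :: "nat \<Rightarrow> nat \<Rightarrow> rat fps" where
  "residue_prod N r = (\<Prod>i<N. 1 - fps_X ^ (18*i + r))"

lemma residue_prod_nth_0: "0 < r \<Longrightarrow> fps_nth (residue_prod N r) 0 = 1"
  by (auto simp: residue_prod_def fps_nth_prod_0 intro!: prod.neutral)

lemma prod_double:
  fixes f :: "nat \<Rightarrow> 'a :: comm_monoid_mult"
  shows "(\<Prod>i<2*N. f i) = (\<Prod>i<N. f (2*i) * f (2*i+1))"
  by (induction N) (simp_all add: mult.assoc)

lemma prod_mod18:
  fixes f :: "nat \<Rightarrow> 'a :: comm_monoid_mult"
  shows "(\<Prod>j=1..18*N. f j) = (\<Prod>r=1..18. \<Prod>i<N. f (18*i + r))"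
proof -
  have "(\<Prod>j=1..18*N. f j) = (\<Prod>j<N*18. f (Suc j))"
    unfolding One_nat_def prod.atLeast1_atMost_eq by (simp only: mult.commute)
  also have "\<dots> = (\<Prod>i<N. \<Prod>j\<in>{i*18..<i*18+18}. f (Suc j))"
    by (rule prod.nat_group[symmetric])
  also have "\<dots> = (\<Prod>i<N. \<Prod>r=1..18. f (18*i + r))"
  proof (rule prod.cong[OF refl])
    fix i
    show "(\<Prod>j\<in>{i*18..<i*18+18}. f (Suc j)) = (\<Prod>r=1..18. f (18*i + r))"
      by (rule prod.reindex_bij_witness[of _ "\<lambda>r. 18*i + r - 1" "\<lambda>j. Suc j - 18*i"]) auto
  qed
  also have "\<dots> = (\<Prod>r=1..18. \<Prod>i<N. f (18*i + r))"
    by (rule prod.swap)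
  finally show ?thesis .
qed

text \<open>Splitting each product over a residue class modulo \<open>9\<close> into two classes modulo \<open>18\<close>. The factors
  \<open>1 + X^(9i+1)\<close> and \<open>1 + X^(9i+8)\<close> become \<open>1 - X^(18i+2)\<close> and \<open>1 - X^(18i+16)\<close> after
  multiplication by their conjugates, and the latter cancel against the classes \<open>2\<close> and \<open>16\<close>.\<close>

lemma agree_theta_residues:
  "agree N (theta N) (\<Prod>r\<in>{1,7,8,9,10,11,17,18}. residue_prod N r)"
proof -
  let ?A = "residue_prod N"
  have q: "qpoch (fps_X ^ a) (fps_X ^ 9) (2*N) = ?A a * ?A (a+9)" for a
    unfolding qpoch_def residue_prod_def prod_double prod.distrib[symmetric]
    by (intro prod.cong refl) (simp add: power_add[symmetric] power_mult[symmetric] algebra_simps del: power_Suc)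
  have Q: "qfact (fps_X ^ 9) (2*N) = ?A 9 * ?A 18"
    unfolding qfact_def One_nat_def prod.atLeast1_atMost_eq residue_prod_def prod_double prod.distrib[symmetric]
    by (intro prod.cong refl) (simp add: power_mult[symmetric] algebra_simps del: power_Suc)
  have m: "agree N (qpoch (- (fps_X ^ a)) (fps_X ^ 9) (2*N) * (?A a * ?A (a+9))) (?A (2*a))" for a
  proof -
    have "qpoch (- (fps_X ^ a)) (fps_X ^ 9) (2*N) * (?A a * ?A (a+9)) = residue_prod (2*N) (2*a)"
      unfolding q[symmetric] unfolding qpoch_def residue_prod_def prod.distrib[symmetric]
    proof (intro prod.cong refl)
      fix i
      have "(fps_X :: rat fps) ^ (18*i + 2*a) = (fps_X ^ a * (fps_X ^ 9) ^ i)^2"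
        by (simp add: power_mult[symmetric] power_add[symmetric] algebra_simps)
      thus "(1 - - (fps_X ^ a) * (fps_X ^ 9) ^ i) * (1 - fps_X ^ a * (fps_X ^ 9) ^ i) = 1 - (fps_X :: rat fps) ^ (18*i + 2*a)"
        by (simp add: algebra_simps power2_eq_square)
    qed
    also have "agree N \<dots> (?A (2*a))"
      unfolding residue_prod_def
    proof (rule agree_prod_superset)
      fix i assume "i \<in> {..<2*N} - {..<N}"
      hence "agree N (1 - fps_X ^ (18*i + 2*a)) (1 - 0)" by (intro agree_diff agree_X_power) auto
      thus "agree N (1 - fps_X ^ (18*i + 2*a)) 1" by simp
    qed auto
    finally show ?thesis .
  qed
  let ?U8 = "qpoch (- (fps_X^8)) (fps_X^9 :: rat fps) (2*N)" and ?U1 = "qpoch (- fps_X) (fps_X^9 :: rat fps) (2*N)"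
  have "agree N (theta N * (?A 16 * ?A 2)) (theta N * ((?U8 * (?A 8 * ?A 17)) * (?U1 * (?A 1 * ?A 10))))"
    using m[of 8] m[of 1] by (intro agree_mult agree_refl) (auto intro: agree_sym)
  also have "\<dots> = (theta N * ?U8 * ?U1) * (?A 1 * ?A 8 * ?A 10 * ?A 17)" by (simp only: mult_ac)
  also have "agree N \<dots> ((qfact (fps_X^9) (2*N) * qpoch (fps_X^7) (fps_X^9) (2*N) * qpoch (fps_X^2) (fps_X^9) (2*N)) * (?A 1 * ?A 8 * ?A 10 * ?A 17))"
    by (intro agree_mult agree_quintuple agree_refl)
  also have "\<dots> = (\<Prod>r\<in>{1,7,8,9,10,11,17,18}. ?A r) * (?A 16 * ?A 2)"
    unfolding q Q by simp
  finally show ?thesis by (rule agree_cancel) (simp add: residue_prod_nth_0)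
qed

definition allowed :: "nat \<Rightarrow> bool" where
  "allowed j \<longleftrightarrow> j mod 18 \<in> {2,3,4,5,6,12,13,14,15,16}"

text \<open>Of the eighteen residue classes modulo \<open>18\<close> in \<open>Q(18N)\<close>, the factor \<open>\<Theta>\<close> cancels eight; the others are the allowed ones.\<close>

lemma agree_product:
  "agree N (theta N * rqfact fps_X (int N)) (\<Prod>j\<in>{j\<in>{1..18*N}. allowed j}. inverse (1 - fps_X ^ j))"
proof -
  let ?A = "residue_prod N" and ?B = "{j\<in>{1..18*N}. allowed j}" and ?R = "{2,3,4,5,6,12,13,14,15,16} :: nat set" and ?T = "{1,7,8,9,10,11,17,18} :: nat set"
  have Q: "qfact fps_X (18*N) = (\<Prod>r\<in>?T. ?A r) * (\<Prod>r\<in>?R. ?A r)"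
  proof -
    have "{1..18} = ?T \<union> ?R" by code_simp
    hence "qfact fps_X (18*N) = (\<Prod>r\<in>?T \<union> ?R. ?A r)"
      unfolding qfact_def prod_mod18 residue_prod_def by simp
    also have "\<dots> = (\<Prod>r\<in>?T. ?A r) * (\<Prod>r\<in>?R. ?A r)"
      by (rule prod.union_disjoint) auto
    finally show ?thesis .
  qed
  have P: "(\<Prod>j\<in>{j\<in>{1..18*N}. allowed j}. 1 - fps_X ^ j) = (\<Prod>r\<in>?R. ?A r)"
  proof -
    have "(\<Prod>j\<in>{j\<in>{1..18*N}. allowed j}. 1 - fps_X ^ j) = (\<Prod>j=1..18*N. if allowed j then 1 - fps_X ^ j else 1 :: rat fps)"
      by (intro prod.inter_filter) simp
    also have "\<dots> = (\<Prod>r=1..18. if r \<in> ?R then ?A r else 1)"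
      unfolding prod_mod18 residue_prod_def
    proof (intro prod.cong refl)
      fix r :: nat assume "r \<in> {1..18}"
      hence "allowed (18*i + r) \<longleftrightarrow> r \<in> ?R" for i
        unfolding allowed_def by (cases "r = 18") auto
      thus "(\<Prod>i<N. if allowed (18*i + r) then 1 - fps_X ^ (18*i + r) else 1)
          = (if r \<in> ?R then \<Prod>i<N. 1 - fps_X ^ (18*i + r) else 1 :: rat fps)" by simp
    qed
    also have "\<dots> = (\<Prod>r\<in>{1..18} \<inter> ?R. ?A r)" by (rule prod.inter_restrict[symmetric]) simp
    also have "{1..18} \<inter> ?R = ?R" by auto
    finally show ?thesis .
  qed
  have inv: "(\<Prod>j\<in>B. inverse (1 - fps_X ^ j)) * (\<Prod>j\<in>B. 1 - fps_X ^ j) = (1 :: rat fps)" if "0 \<notin> B" for B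
    unfolding prod.distrib[symmetric] using that
    by (intro prod.neutral ballI inverse_mult_eq_1) (auto intro: gr0I)
  have Q0: "fps_nth (qfact fps_X (18*N) :: rat fps) 0 = 1"
    using qfact_nth_0[of 1 "18*N"] by simp
  have "agree N (theta N * rqfact fps_X (int N) * qfact fps_X (18*N)) (theta N * rqfact fps_X (int (18*N)) * qfact fps_X (18*N))"
    using agree_rqfact[of N "int N" "int (18*N)" 1] by (intro agree_mult agree_refl) auto
  also have "\<dots> = theta N" using Q0 by (simp add: rqfact_def mult.assoc inverse_mult_eq_1 del: of_nat_mult)
  also have "agree N \<dots> (\<Prod>r\<in>?T. ?A r)" by (rule agree_theta_residues)
  also have "\<dots> = (\<Prod>r\<in>?T. ?A r) * ((\<Prod>j\<in>?B. inverse (1 - fps_X ^ j)) * (\<Prod>j\<in>?B. 1 - fps_X ^ j))"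
    using inv[of ?B] by simp
  also have "\<dots> = (\<Prod>j\<in>?B. inverse (1 - fps_X ^ j)) * qfact fps_X (18*N)"
    unfolding Q P by (simp only: mult_ac)
  finally show ?thesis by (rule agree_cancel) (simp add: Q0)
qed

section \<open>Generating functions of partitions\<close>

text \<open>Partitions are multisets of positive integers, and the multiset language frees the counting below from
  the order of the parts.\<close>

lemma bij_betw_mset_partitions:
  "bij_betw mset {xs. is_partition xs \<and> R (mset xs)} {M. 0 \<notin># M \<and> R M}"
proof (rule bij_betw_byWitness[where f' = "\<lambda>M. rev (sorted_list_of_multiset M)"])
  show "\<forall>xs\<in>{xs. is_partition xs \<and> R (mset xs)}. rev (sorted_list_of_multiset (mset xs)) = xs"
  proof safe
    fix xs assume "is_partition xs"
    hence "sorted (rev xs)" by (simp add: is_partition_def sorted_wrt_rev)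
    hence "sorted_list_of_multiset (mset xs) = rev xs"
      by (metis mset_rev sorted_list_of_multiset_mset sorted_sort_id)
    thus "rev (sorted_list_of_multiset (mset xs)) = xs" by simp
  qed
  show "mset ` {xs. is_partition xs \<and> R (mset xs)} \<subseteq> {M. 0 \<notin># M \<and> R M}"
    by (auto simp: is_partition_def)
  have "sorted_wrt (\<ge>) (rev (sorted_list_of_multiset (M :: nat multiset)))" for M
    by (simp add: sorted_wrt_rev)
  thus "(\<lambda>M. rev (sorted_list_of_multiset M)) ` {M. 0 \<notin># M \<and> R M} \<subseteq> {xs. is_partition xs \<and> R (mset xs)}"
    by (auto simp: is_partition_def intro: gr0I)
qed simp

text \<open>The generating function of the part \<open>j\<close> when its multiplicity is restricted to \<open>C\<close>.\<close>

definition mult_series :: "nat \<Rightarrow> nat set \<Rightarrow> rat fps" where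
  "mult_series j C = Abs_fps (\<lambda>n. if \<exists>c\<in>C. n = j * c then 1 else 0)"

lemma mult_series_mult_nth:
  assumes "0 < a"
  shows "fps_nth (mult_series a C * f) n = (\<Sum>c\<in>{c\<in>C. a * c \<le> n}. fps_nth f (n - a * c))"
proof -
  have "fps_nth (mult_series a C * f) n = (\<Sum>i=0..n. if \<exists>c\<in>C. i = a * c then fps_nth f (n - i) else 0)"
    unfolding fps_mult_nth mult_series_def by (intro sum.cong) auto
  also have "\<dots> = (\<Sum>i\<in>{i\<in>{0..n}. \<exists>c\<in>C. i = a * c}. fps_nth f (n - i))"
    by (rule sum.inter_filter[symmetric]) simp
  also have "{i\<in>{0..n}. \<exists>c\<in>C. i = a * c} = (\<lambda>c. a * c) ` {c\<in>C. a * c \<le> n}" by auto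
  also have "(\<Sum>i\<in>(\<lambda>c. a * c) ` {c\<in>C. a * c \<le> n}. fps_nth f (n - i)) = (\<Sum>c\<in>{c\<in>C. a * c \<le> n}. fps_nth f (n - a * c))"
    using assms by (subst sum.reindex) (auto simp: inj_on_def)
  finally show ?thesis .
qed

lemma mult_series_UNIV:
  assumes "0 < j"
  shows "mult_series j UNIV = inverse (1 - fps_X ^ j)"
proof -
  have nth: "fps_nth (mult_series j UNIV) n = (if j dvd n then 1 else 0)" for n
    by (simp add: mult_series_def dvd_def)
  have "(1 - fps_X ^ j) * mult_series j UNIV = 1"
  proof (rule fps_ext)
    fix n
    show "fps_nth ((1 - fps_X ^ j) * mult_series j UNIV) n = fps_nth 1 n"
    proof (cases "n < j")
      case True
      thus ?thesis by (auto simp: left_diff_distrib fps_X_power_mult_nth nth dest: nat_dvd_not_less[rotated])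
    next
      case False
      thus ?thesis using assms by (simp add: left_diff_distrib fps_X_power_mult_nth nth dvd_minus_self)
    qed
  qed
  moreover have "fps_nth (1 - fps_X ^ j :: rat fps) 0 \<noteq> 0" using assms by simp
  ultimately show ?thesis by (metis fps_inverse_unique)
qed

lemma mult_series_ge_1_even:
  assumes "0 < j"
  shows "mult_series j {c. 1 \<le> c} = fps_X ^ j * inverse (1 - fps_X ^ j)"
    "mult_series j {c. even c \<and> 2 \<le> c} = fps_X ^ (2*j) * inverse (1 - fps_X ^ (2*j))"
proof -
  have "mult_series j {c. 1 \<le> c} = fps_X ^ j * mult_series j UNIV"
  proof (rule fps_ext)
    fix n
    have "(\<exists>c\<in>{c::nat. 1 \<le> c}. n = j * c) \<longleftrightarrow> j \<le> n \<and> (\<exists>c. n - j = j * c)"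
    proof safe
      fix c :: nat assume "1 \<le> c" thus "j \<le> j * c" "\<exists>d. j * c - j = j * d"
        by (auto intro!: exI[of _ "c - 1"] simp: right_diff_distrib')
    next
      fix c assume "j \<le> n" "n - j = j * c"
      thus "\<exists>c\<in>{c. 1 \<le> c}. n = j * c" by (intro bexI[of _ "Suc c"]) auto
    qed
    thus "fps_nth (mult_series j {c. 1 \<le> c}) n = fps_nth (fps_X ^ j * mult_series j UNIV) n"
      by (auto simp: fps_X_power_mult_nth mult_series_def)
  qed
  thus "mult_series j {c. 1 \<le> c} = fps_X ^ j * inverse (1 - fps_X ^ j)"
    by (simp add: mult_series_UNIV[OF assms])
  show "mult_series j {c. even c \<and> 2 \<le> c} = fps_X ^ (2*j) * inverse (1 - fps_X ^ (2*j))"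
  proof -
    have "mult_series j {c. even c \<and> 2 \<le> c} = fps_X ^ (2*j) * mult_series (2*j) UNIV"
    proof (rule fps_ext)
      fix n
      have "(\<exists>c\<in>{c. even c \<and> 2 \<le> c}. n = j * c) \<longleftrightarrow> 2*j \<le> n \<and> (\<exists>c. n - 2*j = 2*j * c)"
      proof safe
        fix c :: nat assume "even c" "2 \<le> c"
        then obtain d where "c = 2 * Suc d" by (metis dvdE mult_0_right not_numeral_le_zero not0_implies_Suc)
        thus "2*j \<le> j * c" "\<exists>d. j * c - 2*j = 2*j * d"
          by (auto intro!: exI[of _ d])
      next
        fix c assume "2*j \<le> n" "n - 2*j = 2*j * c"
        thus "\<exists>c\<in>{c. even c \<and> 2 \<le> c}. n = j * c" by (intro bexI[of _ "2 * Suc c"]) auto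
      qed
      thus "fps_nth (mult_series j {c. even c \<and> 2 \<le> c}) n = fps_nth (fps_X ^ (2*j) * mult_series (2*j) UNIV) n"
        by (auto simp: fps_X_power_mult_nth mult_series_def)
    qed
    thus ?thesis using mult_series_UNIV[of "2*j"] assms by simp
  qed
qed

text \<open>Choosing the multiplicity of one further part \<open>a\<close> is independent of the rest, which is the Cauchy product
  with \<open>mult_series a (C a)\<close>.\<close>

lemma count_multisets:
  fixes A :: "nat set" and C :: "nat \<Rightarrow> nat set"
  assumes "finite A" "0 \<notin> A"
  defines "Z \<equiv> \<lambda>A n. {M. set_mset M \<subseteq> A \<and> (\<forall>j\<in>A. count M j \<in> C j) \<and> sum_mset M = n}"
  shows "finite (Z A n) \<and> of_nat (card (Z A n)) = fps_nth (\<Prod>j\<in>A. mult_series j (C j)) n"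
  using assms(1,2)
proof (induction A arbitrary: n)
  case empty
  have "Z {} n = (if n = 0 then {{#}} else {})" by (auto simp: Z_def)
  thus ?case by auto
next
  case (insert a A)
  hence a: "0 < a" and A: "0 \<notin> A" by auto
  define K where "K = {c\<in>C a. a * c \<le> n}"
  have "c \<le> a * c" for c using a by simp
  hence "K \<subseteq> {..n}" unfolding K_def using order_trans by blast
  hence K: "finite K" by (rule finite_subset) simp
  let ?f = "\<lambda>c M. M + replicate_mset c a"
  have cnt: "count M a = 0" if "M \<in> Z A k" for M k
    using that insert.hyps(2) by (auto simp: Z_def count_eq_zero_iff)
  have eq: "Z (insert a A) n = (\<Union>c\<in>K. ?f c ` Z A (n - a * c))"
  proof (intro equalityI subsetI)
    fix M assume M: "M \<in> Z (insert a A) n"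
    define c where "c = count M a"
    define M' where "M' = filter_mset (\<lambda>x. x \<noteq> a) M"
    have dec: "M = M' + replicate_mset c a"
      unfolding M'_def c_def by (rule multiset_eqI) auto
    have s: "n = sum_mset M' + a * c" using M by (subst (asm) dec) (simp add: Z_def mult.commute)
    have "M' \<in> Z A (n - a * c)"
      using M insert.hyps(2) s by (auto simp: Z_def M'_def)
    moreover have "c \<in> K" using M s by (auto simp: K_def Z_def c_def)
    ultimately show "M \<in> (\<Union>c\<in>K. ?f c ` Z A (n - a * c))" using dec by blast
  next
    fix M assume "M \<in> (\<Union>c\<in>K. ?f c ` Z A (n - a * c))"
    then obtain c M' where *: "c \<in> K" "M' \<in> Z A (n - a * c)" "M = M' + replicate_mset c a" by blast
    have "count M' a = 0" using cnt *(2) .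
    thus "M \<in> Z (insert a A) n"
      using * insert.hyps(2) by (auto simp: Z_def K_def mult.commute split: if_splits)
  qed
  have disj: "?f c ` Z A (n - a * c) \<inter> ?f d ` Z A (n - a * d) = {}" if "c \<noteq> d" for c d
  proof -
    have *: "count M a = e" if "M \<in> ?f e ` Z A (n - a * e)" for M e
      using that cnt by auto
    show ?thesis
    proof (rule equals0I, erule IntE)
      fix M assume "M \<in> ?f c ` Z A (n - a * c)" "M \<in> ?f d ` Z A (n - a * d)"
      from this[THEN *] that show False by simp
    qed
  qed
  have fin: "finite (?f c ` Z A (n - a * c))" for c using insert.IH[OF A] by simp
  have "card (Z (insert a A) n) = (\<Sum>c\<in>K. card (?f c ` Z A (n - a * c)))"
    unfolding eq using K fin disj by (intro card_UN_disjoint) auto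
  also have "\<dots> = (\<Sum>c\<in>K. card (Z A (n - a * c)))"
    by (intro sum.cong refl card_image) (auto simp: inj_on_def)
  finally have "of_nat (card (Z (insert a A) n)) = (\<Sum>c\<in>K. fps_nth (\<Prod>j\<in>A. mult_series j (C j)) (n - a * c))"
    using insert.IH[OF A] by simp
  also have "\<dots> = fps_nth (mult_series a (C a) * (\<Prod>j\<in>A. mult_series j (C j))) n"
    unfolding mult_series_mult_nth[OF a] K_def ..
  also have "mult_series a (C a) * (\<Prod>j\<in>A. mult_series j (C j)) = (\<Prod>j\<in>insert a A. mult_series j (C j))"
    using insert.hyps by simp
  finally show ?case unfolding eq using K fin by auto
qed

lemma count_partitions:
  fixes A :: "nat set" and C :: "nat \<Rightarrow> nat set" and n :: nat
  assumes "finite A" "0 \<notin> A"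
  defines "Z \<equiv> {xs. partition_of n xs \<and> set xs \<subseteq> A \<and> (\<forall>j\<in>A. count_list xs j \<in> C j)}"
  shows "finite Z \<and> of_nat (card Z) = fps_nth (\<Prod>j\<in>A. mult_series j (C j)) n"
proof -
  let ?R = "\<lambda>M. set_mset M \<subseteq> A \<and> (\<forall>j\<in>A. count M j \<in> C j) \<and> sum_mset M = n"
  have "Z = {xs. is_partition xs \<and> ?R (mset xs)}"
    by (auto simp: Z_def partition_of_def count_mset sum_mset_sum_list)
  hence "bij_betw mset Z {M. 0 \<notin># M \<and> ?R M}" using bij_betw_mset_partitions[of ?R] by simp
  moreover have "{M. 0 \<notin># M \<and> ?R M} = {M. ?R M}" using assms(2) by auto
  ultimately have bij: "bij_betw mset Z {M. ?R M}" by (simp only:)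
  show ?thesis
    using count_multisets[OF assms(1,2), of C n]
    unfolding bij_betw_same_card[OF bij] bij_betw_finite[OF bij] .
qed

lemma prod_one_plus_X_power:
  fixes a :: "nat \<Rightarrow> nat"
  assumes "finite A"
  shows "(\<Prod>j\<in>A. 1 + fps_X ^ a j) = (\<Sum>J\<in>Pow A. fps_X ^ (\<Sum>j\<in>J. a j) :: rat fps)"
  using prod_add[OF assms, of "\<lambda>j. fps_X ^ a j :: rat fps" "\<lambda>_. 1"]
  by (simp add: add.commute power_sum)

definition negative_parts :: "nat \<Rightarrow> nat list set" where
  "negative_parts m = {v. is_partition v \<and> length v = m \<and>
     (\<forall>j\<in>set v. [j = 1] (mod 3) \<and> j \<le> 3 * m - 2 \<and> (1 < j \<longrightarrow> count_list v j \<le> 1))}"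

text \<open>The negative parts that belong to the set \<open>J\<close>: the parts \<open>3j + 1\<close> with \<open>j \<in> J\<close>, padded with ones to
  the required number \<open>m\<close>.\<close>

definition negative_mset :: "nat \<Rightarrow> nat set \<Rightarrow> nat multiset" where
  "negative_mset m J = replicate_mset (m - card J) 1 + mset_set ((\<lambda>j. 3 * j + 1) ` J)"

text \<open>The map \<open>J \<mapsto> negative_mset m J\<close> is a bijection from the subsets of \<open>{1, ..., m-1}\<close>, and the sum of the parts
  is \<open>m + 3 \<Sum>J\<close>, as each \<open>j \<in> J\<close> raises a one to \<open>3j + 1\<close>.\<close>

lemma sum_negative_parts:
  fixes f :: "nat \<Rightarrow> 'a::comm_monoid_add"
  assumes m: "0 < m"
  shows "finite (negative_parts m)"
    "(\<Sum>v\<in>negative_parts m. f (sum_list v)) = (\<Sum>J\<in>Pow {1..<m}. f (m + 3 * \<Sum>J))"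
proof -
  let ?R = "\<lambda>M. size M = m \<and> (\<forall>j\<in>#M. [j = 1] (mod 3) \<and> j \<le> 3 * m - 2 \<and> (1 < j \<longrightarrow> count M j \<le> 1))"
  let ?V = "{M. 0 \<notin># M \<and> ?R M}"
  let ?g = "negative_mset m" and ?h = "\<lambda>M. {j\<in>{1..<m}. 3 * j + 1 \<in># M}"
  have "negative_parts m = {v. is_partition v \<and> ?R (mset v)}"
    by (simp add: negative_parts_def count_mset)
  hence bij1: "bij_betw mset (negative_parts m) ?V"
    using bij_betw_mset_partitions[of ?R] by simp
  have J: "finite J" "card J \<le> m" "0 \<notin> J" if "J \<in> Pow {1..<m}" for J
  proof -
    have "card J \<le> card {1..<m}" using that by (intro card_mono) auto
    thus "card J \<le> m" by simp
  qed (use that finite_subset in auto)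
  have count_g: "count (?g J) x = (if x = 1 then m - card J else 0) + (if x \<in> (\<lambda>j. 3 * j + 1) ` J then 1 else 0)"
    if "J \<in> Pow {1..<m}" for J x
    using J[OF that] by (simp add: negative_mset_def)
  have inj: "inj_on (\<lambda>j::nat. 3 * j + 1) J" for J by (auto simp: inj_on_def)
  have bij2: "bij_betw ?g (Pow {1..<m}) ?V"
  proof (rule bij_betw_byWitness[where f' = ?h])
    show "\<forall>J\<in>Pow {1..<m}. ?h (?g J) = J"
    proof
      fix J assume JP: "J \<in> Pow {1..<m}"
      have "3 * j + 1 \<in># ?g J \<longleftrightarrow> j \<in> J" if "j \<in> {1..<m}" for j
        using that count_g[OF JP, of "3 * j + 1"] by (auto simp: count_greater_zero_iff[symmetric] simp del: count_greater_zero_iff)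
      thus "?h (?g J) = J" using JP by auto
    qed
    show "?g ` Pow {1..<m} \<subseteq> ?V"
    proof safe
      fix J assume "J \<subseteq> {1..<m}"
      hence JP: "J \<in> Pow {1..<m}" by simp
      have sub: "x = 1 \<or> x \<in> (\<lambda>j. 3 * j + 1) ` J" if "x \<in># ?g J" for x
        using that count_g[OF JP, of x] by (auto simp: count_greater_zero_iff[symmetric] simp del: count_greater_zero_iff split: if_splits)
      show "False" if "0 \<in># ?g J" using sub[OF that] by auto
      show "size (?g J) = m"
        using J[OF JP] inj[of J] by (simp add: negative_mset_def card_image)
      fix x assume x: "x \<in># ?g J"
      show "[x = 1] (mod 3)" using sub[OF x] by (auto simp: cong_def)
      have "j < m" if "j \<in> J" for j using JP that by auto
      thus "x \<le> 3 * m - 2" using sub[OF x] m by fastforce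
      show "count (?g J) x \<le> 1" if "1 < x" using that count_g[OF JP, of x] by auto
    qed
    show "?h ` ?V \<subseteq> Pow {1..<m}" by auto
    show "\<forall>M\<in>?V. ?g (?h M) = M"
    proof
      fix M assume M: "M \<in> ?V"
      let ?J = "?h M"
      have JP: "?J \<in> Pow {1..<m}" by auto
      have form: "x = 1 \<or> x \<in> (\<lambda>j. 3 * j + 1) ` ?J" if "x \<in># M" for x
      proof -
        have *: "x mod 3 = 1" "x \<le> 3 * m - 2" using M that by (auto simp: cong_def)
        define j where "j = x div 3"
        have x: "x = 3 * j + 1" using *(1) unfolding j_def by presburger
        thus ?thesis using *(2) that by (cases "j = 0") auto
      qed
      have big: "count M (3 * j + 1) = 1" if "j \<in> ?J" for j
      proof -
        have "3 * j + 1 \<in># M" "1 < 3 * j + 1" using that by auto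
        hence "count M (3 * j + 1) \<le> 1" "0 < count M (3 * j + 1)" using M by auto
        thus ?thesis by linarith
      qed
      have dec: "M = replicate_mset (count M 1) 1 + mset_set ((\<lambda>j. 3 * j + 1) ` ?J)"
      proof (rule multiset_eqI)
        fix x
        have fin: "finite ((\<lambda>j. 3 * j + 1) ` ?J)" by simp
        show "count M x = count (replicate_mset (count M 1) 1 + mset_set ((\<lambda>j. 3 * j + 1) ` ?J)) x"
        proof (cases "x \<in># M")
          case True
          show ?thesis
          proof (cases "x = 1")
            case True
            moreover have "1 \<notin> (\<lambda>j. 3 * j + 1) ` ?J" by auto
            ultimately show ?thesis by simp
          next
            case False
            then obtain j where "j \<in> ?J" "x = 3 * j + 1" using form[OF True] by blast
            thus ?thesis using big[of j] fin False by (auto simp: image_iff)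
          qed
        next
          case False
          hence "x \<notin> (\<lambda>j. 3 * j + 1) ` ?J" by auto
          thus ?thesis using False fin by (auto simp: not_in_iff)
        qed
      qed
      have "size M = count M 1 + card ?J"
        using card_image[OF inj, of ?J] by (subst dec) simp
      moreover have "size M = m" using M by simp
      ultimately have "count M 1 = m - card ?J" by linarith
      thus "?g ?J = M" unfolding negative_mset_def using dec by simp
    qed
  qed
  show fin: "finite (negative_parts m)"
    using bij_betw_finite[OF bij1] bij_betw_finite[OF bij2] by simp
  have sum_g: "sum_mset (?g J) = m + 3 * \<Sum>J" if "J \<in> Pow {1..<m}" for J
  proof -
    have "sum_mset (mset_set ((\<lambda>j. 3 * j + 1) ` J)) = (\<Sum>j\<in>J. 3 * j + 1)"
      using sum_unfold_sum_mset[of "\<lambda>x. x" "(\<lambda>j. 3 * j + 1) ` J"] sum.reindex[OF inj, of "\<lambda>x. x" J]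
      unfolding multiset.map_ident comp_def by (simp only:)
    also have "\<dots> = 3 * \<Sum>J + card J" by (simp only: sum.distrib sum_distrib_left) simp
    finally show ?thesis using J[OF that] by (simp add: negative_mset_def)
  qed
  have "(\<Sum>v\<in>negative_parts m. f (sum_list v)) = (\<Sum>v\<in>negative_parts m. f (sum_mset (mset v)))"
    by (simp add: sum_mset_sum_list)
  also have "\<dots> = (\<Sum>M\<in>?V. f (sum_mset M))"
    by (rule sum.reindex_bij_betw[OF bij1])
  also have "\<dots> = (\<Sum>J\<in>Pow {1..<m}. f (sum_mset (?g J)))"
    by (rule sum.reindex_bij_betw[OF bij2, symmetric])
  also have "\<dots> = (\<Sum>J\<in>Pow {1..<m}. f (m + 3 * \<Sum>J))"
    by (intro sum.cong refl) (simp only: sum_g)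
  finally show "(\<Sum>v\<in>negative_parts m. f (sum_list v)) = (\<Sum>J\<in>Pow {1..<m}. f (m + 3 * \<Sum>J))" .
qed

definition pos_mult :: "nat \<Rightarrow> nat \<Rightarrow> nat set" where
  "pos_mult m j = (if j < m then {c. even c \<and> 2 \<le> c} else {c. 1 \<le> c})"

definition pos_gf :: "nat \<Rightarrow> rat fps" where
  "pos_gf m = (\<Prod>j\<in>{1..2*m}. mult_series j (pos_mult m j))"

definition pos_parts :: "nat \<Rightarrow> nat \<Rightarrow> nat list set" where
  "pos_parts m n = {p. partition_of n p \<and> set p \<subseteq> {1..2*m} \<and> (\<forall>j\<in>{1..2*m}. count_list p j \<in> pos_mult m j)}"

lemma pos_parts:
  "finite (pos_parts m n)" "of_nat (card (pos_parts m n)) = fps_nth (pos_gf m) n"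
  using count_partitions[of "{1..2*m}" n "pos_mult m"] by (auto simp: pos_parts_def pos_gf_def)

text \<open>The signed partitions of \<open>n\<close> with largest positive part \<open>2m\<close>: the choice of the negative parts \<open>v\<close>
  determines the weight \<open>n + |v|\<close> of the positive ones.\<close>

definition signed_parts :: "nat \<Rightarrow> nat \<Rightarrow> (nat list \<times> nat list) set" where
  "signed_parts m n = (SIGMA v:negative_parts m. pos_parts m (n + sum_list v))\<inverse>"

lemma complement_sum:
  assumes "J \<in> Pow {1..<m::nat}"
  shows "\<Sum>({1..<m} - J) + \<Sum>J = \<Sum>{1..<m}"
  using assms sum.subset_diff[of J "{1..<m}" "\<lambda>x. x"] by simp

text \<open>Replacing \<open>J\<close> by its complement turns the weight \<open>n + m + 3 \<Sum>J\<close> of the positive parts into a constant minus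
  \<open>3 \<Sum>J\<close>, so that negative exponents disappear and the count is a coefficient of an ordinary product.\<close>

lemma card_signed_parts_coeff:
  assumes "0 < m"
  shows "finite (signed_parts m n)"
    "of_nat (card (signed_parts m n)) = fps_nth (pos_gf m * (\<Prod>j=1..<m. 1 + fps_X ^ (3*j))) (n + m + 3 * \<Sum>{1..<m})"
proof -
  note fin = sum_negative_parts(1)[OF assms]
  show "finite (signed_parts m n)"
    unfolding signed_parts_def using fin pos_parts(1) by auto
  let ?T = "\<Sum>{1..<m}"
  have "card (signed_parts m n) = (\<Sum>v\<in>negative_parts m. card (pos_parts m (n + sum_list v)))"
    unfolding signed_parts_def card_inverse using fin pos_parts(1) by (subst card_SigmaI) auto
  hence "of_nat (card (signed_parts m n)) = (\<Sum>v\<in>negative_parts m. fps_nth (pos_gf m) (n + sum_list v))"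
    by (simp add: pos_parts(2))
  also have "\<dots> = (\<Sum>J\<in>Pow {1..<m}. fps_nth (pos_gf m) (n + (m + 3 * \<Sum>J)))"
    by (rule sum_negative_parts(2)[OF assms])
  also have "\<dots> = (\<Sum>J\<in>Pow {1..<m}. fps_nth (pos_gf m) (n + (m + 3 * \<Sum>({1..<m} - J))))"
    by (rule sum.reindex_bij_witness[of _ "\<lambda>J. {1..<m} - J" "\<lambda>J. {1..<m} - J"]) (auto simp: double_diff)
  also have "\<dots> = (\<Sum>J\<in>Pow {1..<m}. fps_nth (pos_gf m * fps_X ^ (3 * \<Sum>J)) (n + m + 3 * ?T))"
  proof (intro sum.cong refl)
    fix J assume "J \<in> Pow {1..<m}"
    from complement_sum[OF this]
    have "n + (m + 3 * \<Sum>({1..<m} - J)) = n + m + 3 * ?T - 3 * \<Sum>J" "3 * \<Sum>J \<le> n + m + 3 * ?T" by linarith+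
    thus "fps_nth (pos_gf m) (n + (m + 3 * \<Sum>({1..<m} - J))) = fps_nth (pos_gf m * fps_X ^ (3 * \<Sum>J)) (n + m + 3 * ?T)"
      by (simp add: fps_X_power_mult_right_nth)
  qed
  also have "\<dots> = fps_nth (pos_gf m * (\<Sum>J\<in>Pow {1..<m}. fps_X ^ (3 * \<Sum>J))) (n + m + 3 * ?T)"
    by (simp add: sum_distrib_left fps_sum_nth)
  also have "(\<Sum>J\<in>Pow {1..<m}. fps_X ^ (3 * \<Sum>J)) = (\<Prod>j=1..<m. 1 + fps_X ^ (3*j) :: rat fps)"
    by (subst prod_one_plus_X_power) (simp_all add: sum_distrib_left)
  finally show "of_nat (card (signed_parts m n)) = fps_nth (pos_gf m * (\<Prod>j=1..<m. 1 + fps_X ^ (3*j))) (n + m + 3 * ?T)" .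
qed

text \<open>The positive parts weigh at least \<open>2 (1 + \<dots> + (m-1)) + (m + \<dots> + 2m)\<close>, which is the power of \<open>X\<close> that splits
  off. For the rest, \<open>(1 + X^(3j))(1 - X^j)\<close> equals
  \<open>(1 - X^j + X^(2j))(1 - X^(2j))\<close>.\<close>

lemma signed_gf_eq:
  assumes m: "0 < m"
  shows "pos_gf m * (\<Prod>j=1..<m. 1 + fps_X ^ (3*j))
    = fps_X ^ (m + 3 * \<Sum>{1..<m}) * (fps_X ^ (m^2+m) * phi6_prod fps_X m * rqfact fps_X (2 * int m))"
proof -
  let ?X = "fps_X :: rat fps"
  have split: "{1..2*m} = {1..<m} \<union> {m..2*m}" using m by auto
  have gf: "pos_gf m = (\<Prod>j=1..<m. ?X ^ (2*j) * inverse (1 - ?X ^ (2*j))) * (\<Prod>j=m..2*m. ?X ^ j * inverse (1 - ?X ^ j))"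
  proof -
    have "pos_gf m = (\<Prod>j=1..<m. mult_series j (pos_mult m j)) * (\<Prod>j=m..2*m. mult_series j (pos_mult m j))"
      unfolding pos_gf_def split by (rule prod.union_disjoint) auto
    also have "(\<Prod>j=1..<m. mult_series j (pos_mult m j)) = (\<Prod>j=1..<m. ?X ^ (2*j) * inverse (1 - ?X ^ (2*j)))"
      by (intro prod.cong refl) (simp add: pos_mult_def mult_series_ge_1_even)
    also have "(\<Prod>j=m..2*m. mult_series j (pos_mult m j)) = (\<Prod>j=m..2*m. ?X ^ j * inverse (1 - ?X ^ j))"
      using m mult_series_ge_1_even(1) by (intro prod.cong refl) (simp add: pos_mult_def)
    finally show ?thesis .
  qed
  have e: "2 * \<Sum>{1..<m} + \<Sum>{m..2*m} = m + 3 * \<Sum>{1..<m} + (m^2+m)"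
  proof -
    have 1: "2 * \<Sum>{1..<m} + m = m^2"
      by (induction m) (auto simp: power2_eq_square)
    have "2 * \<Sum>{1..k} = k^2 + k" for k :: nat
      by (induction k) (auto simp: power2_eq_square)
    from this[of "2*m"] have "2 * \<Sum>{1..2*m} = 4*m^2 + 2*m" by (simp add: power_mult_distrib)
    moreover have "\<Sum>{1..2*m} = \<Sum>{1..<m} + \<Sum>{m..2*m}"
      unfolding split by (rule sum.union_disjoint) auto
    ultimately show ?thesis using 1 by linarith
  qed
  let ?D = "\<Prod>j=1..<m. 1 - ?X ^ (2*j)" and ?E = "\<Prod>j=m..2*m. 1 - ?X ^ j" and ?I = "\<Prod>j=1..<m. inverse (1 - ?X ^ (2*j))"
    and ?H = "\<Prod>j=m..2*m. inverse (1 - ?X ^ j)" and ?P = "\<Prod>j=1..<m. 1 + ?X ^ (3*j)" and ?F = "\<Prod>j=1..<m. 1 - ?X ^ j"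
  have D: "?I * ?D = 1" "?H * ?E = 1"
    unfolding prod.distrib[symmetric] using m by (intro prod.neutral ballI inverse_mult_eq_1, simp)+
  have F: "?P * ?F = phi6_prod ?X m * ?D"
    unfolding phi6_prod_def prod.distrib[symmetric]
  proof (intro prod.cong refl)
    fix j
    have "?X ^ (2*j) = (?X ^ j)^2" "?X ^ (3*j) = (?X ^ j)^3" by (simp_all add: power_mult[symmetric] mult.commute)
    thus "(1 + ?X ^ (3*j)) * (1 - ?X ^ j) = (1 - ?X ^ j + ?X ^ (2*j)) * (1 - ?X ^ (2*j))"
      by (simp add: algebra_simps power2_eq_square power3_eq_cube)
  qed
  have Q: "qfact ?X (2*m) = ?F * ?E"
    unfolding qfact_def split by (rule prod.union_disjoint) auto
  have "fps_nth (qfact ?X (2*m)) 0 \<noteq> 0"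
    by (auto simp: qfact_def fps_nth_prod_0)
  hence iq: "qfact ?X (2*m) * rqfact ?X (2 * int m) = 1"
    using nat_int[of "2*m"] by (simp add: rqfact_def inverse_mult_eq_1' nat_mult_distrib)
  have "?I * ?H * ?P = ?I * ?H * ?P * (?F * ?E * rqfact ?X (2 * int m))"
    using iq unfolding Q by simp
  also have "\<dots> = ?I * (?H * ?E) * (?P * ?F) * rqfact ?X (2 * int m)" by (simp only: mult_ac)
  also have "\<dots> = (?I * ?D) * (phi6_prod ?X m * rqfact ?X (2 * int m))"
    unfolding D(2) F by (simp only: mult_ac mult_1_left mult_1_right)
  finally have *: "?I * ?H * ?P = phi6_prod ?X m * rqfact ?X (2 * int m)" unfolding D(1) by simp
  have "pos_gf m = ?X ^ (2 * \<Sum>{1..<m} + \<Sum>{m..2*m}) * (?I * ?H)"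
    unfolding gf prod.distrib power_sum[symmetric] by (simp only: sum_distrib_left power_add mult_ac)
  hence "pos_gf m * ?P = ?X ^ (m + 3 * \<Sum>{1..<m} + (m^2+m)) * (?I * ?H * ?P)"
    unfolding e by (simp only: mult_ac)
  also have "\<dots> = ?X ^ (m + 3 * \<Sum>{1..<m}) * (?X ^ (m^2+m) * phi6_prod ?X m * rqfact ?X (2 * int m))"
    unfolding * by (simp only: power_add mult_ac)
  finally show ?thesis .
qed

lemma card_signed_parts:
  assumes "0 < m"
  shows "of_nat (card (signed_parts m n)) = fps_nth (fps_X ^ (m^2+m) * phi6_prod fps_X m * rqfact fps_X (2 * int m) :: rat fps) n"
  unfolding card_signed_parts_coeff(2)[OF assms] signed_gf_eq[OF assms]
  by (simp add: fps_X_power_mult_nth mult.assoc)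

lemma allowed_iff:
  "(\<exists>r\<in>{2..6}. [int j = r] (mod 18) \<or> [int j = - r] (mod 18)) \<longleftrightarrow> allowed j"
proof -
  have r: "{2..6} = {2,3,4,5,6::int}" by auto
  have m: "int j mod 18 = int (j mod 18)" by (simp add: zmod_int)
  show ?thesis unfolding r allowed_def cong_def m by auto
qed

lemma card_allowed_partitions:
  assumes "n < N"
  shows "of_nat (card {xs. partition_of n xs \<and> (\<forall>j\<in>set xs. allowed j)}) 
    = fps_nth (\<Prod>j\<in>{j\<in>{1..18*N}. allowed j}. inverse (1 - fps_X ^ j) :: rat fps) n"
proof -
  let ?A = "{j\<in>{1..18*N}. allowed j}"
  have "x \<le> n" if "partition_of n xs" "x \<in> set xs" for x xs
    using that member_le_sum_list by (auto simp: partition_of_def)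
  moreover have "1 \<le> x" if "partition_of n xs" "x \<in> set xs" for x xs
    using that by (fastforce simp: partition_of_def is_partition_def)
  ultimately have "set xs \<subseteq> ?A \<longleftrightarrow> (\<forall>j\<in>set xs. allowed j)" if "partition_of n xs" for xs
    using that assms by fastforce
  hence "{xs. partition_of n xs \<and> (\<forall>j\<in>set xs. allowed j)} = {xs. partition_of n xs \<and> set xs \<subseteq> ?A \<and> (\<forall>j\<in>?A. count_list xs j \<in> UNIV)}"
    by auto
  moreover have "(\<Prod>j\<in>?A. mult_series j UNIV) = (\<Prod>j\<in>?A. inverse (1 - fps_X ^ j))"
    by (intro prod.cong refl mult_series_UNIV) simp
  ultimately show ?thesis using count_partitions[of ?A n "\<lambda>_. UNIV"] by simp
qed

text \<open>As the part \<open>2m\<close> is required to occur, confining the parts to \<open>{1, ..., 2m}\<close> is the same as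
  requiring the largest one to be \<open>2m\<close>.\<close>

lemma mem_pos_parts_iff:
  assumes "0 < m"
  shows "p \<in> pos_parts m k \<longleftrightarrow> partition_of k p \<and> p \<noteq> [] \<and> hd p = 2 * m
    \<and> (\<forall>i\<in>{1..<m}. even (count_list p i) \<and> 2 \<le> count_list p i) \<and> (\<forall>i\<in>{m..2*m}. 1 \<le> count_list p i)"
proof -
  have split: "{1..2*m} = {1..<m} \<union> {m..2*m}" using assms by auto
  have mult: "(\<forall>j\<in>{1..2*m}. count_list p j \<in> pos_mult m j) \<longleftrightarrow>
      (\<forall>i\<in>{1..<m}. even (count_list p i) \<and> 2 \<le> count_list p i) \<and> (\<forall>i\<in>{m..2*m}. 1 \<le> count_list p i)"
    unfolding split ball_Un by (auto simp: pos_mult_def)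
  have top: "set p \<subseteq> {1..2*m} \<longleftrightarrow> p \<noteq> [] \<and> hd p = 2 * m" if "is_partition p" "1 \<le> count_list p (2*m)"
  proof
    have "2 * m \<in> set p" using that(2) by (metis count_notin not_one_le_zero)
    moreover assume "set p \<subseteq> {1..2*m}"
    ultimately show "p \<noteq> [] \<and> hd p = 2 * m"
      using that(1) by (cases p) (auto simp: is_partition_def intro: antisym)
  next
    assume "p \<noteq> [] \<and> hd p = 2 * m"
    thus "set p \<subseteq> {1..2*m}"
      using that(1) by (cases p) (auto simp: is_partition_def Suc_le_eq)
  qed
  have "1 \<le> count_list p (2*m)" if "\<forall>i\<in>{m..2*m}. 1 \<le> count_list p i"
    using that by simp
  thus ?thesis unfolding pos_parts_def mem_Collect_eq mult partition_of_def
    using top by blast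
qed

section \<open>The partition identity\<close>

theorem theorem5p16:
  fixes n :: nat
  assumes "0 < n"
  defines "S \<equiv> {(p, v). signed_partition_of (int n) (p, v) \<and> p \<noteq> [] \<and>
      even (hd p) \<and>
      (\<forall>i\<in>{1..<hd p div 2}. even (count_list p i) \<and> 2 \<le> count_list p i) \<and>
      (\<forall>i\<in>{hd p div 2..hd p}. 1 \<le> count_list p i) \<and>
      length v = hd p div 2 \<and>
      (\<forall>j\<in>set v. [j = 1] (mod 3) \<and> j \<le> 3 * hd p div 2 - 2 \<and>
         (1 < j \<longrightarrow> count_list v j \<le> 1))}"
  shows "finite S \<and>
    card S = card {xs. partition_of n xs \<and>
      (\<forall>j\<in>set xs. \<exists>r\<in>{2..6}. [int j = r] (mod 18) \<or> [int j = - r] (mod 18))}"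
proof -
  let ?t = "\<lambda>m. fps_X ^ (m^2+m) * phi6_prod fps_X m * rqfact fps_X (2 * int m) :: rat fps"
  have mem: "(p, v) \<in> S \<longleftrightarrow> (\<exists>m>0. (p, v) \<in> signed_parts m n)" for p v
  proof
    assume pv: "(p, v) \<in> S"
    define m where "m = hd p div 2"
    have p: "p \<noteq> []" "even (hd p)" "is_partition p" using pv by (auto simp: S_def signed_partition_of_def)
    have hd: "hd p = 2 * m" using p(2) by (simp add: m_def)
    have "0 < hd p" using p(1,3) by (auto simp: is_partition_def)
    hence m: "0 < m" using hd by simp
    have "sum_list p = n + sum_list v" using pv by (auto simp: S_def signed_partition_of_def)
    hence "p \<in> pos_parts m (n + sum_list v)"
      using pv p hd unfolding mem_pos_parts_iff[OF m] by (auto simp: S_def partition_of_def)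
    moreover have "v \<in> negative_parts m"
      using pv hd by (auto simp: S_def negative_parts_def signed_partition_of_def)
    ultimately show "\<exists>m>0. (p, v) \<in> signed_parts m n" using m by (auto simp: signed_parts_def)
  next
    assume "\<exists>m>0. (p, v) \<in> signed_parts m n"
    then obtain m where m: "0 < m" and *: "v \<in> negative_parts m" "p \<in> pos_parts m (n + sum_list v)"
      by (auto simp: signed_parts_def)
    note p = *(2)[unfolded mem_pos_parts_iff[OF m]]
    have "int n = int (sum_list p) - int (sum_list v)" using p by (simp add: partition_of_def)
    thus "(p, v) \<in> S"
      using p *(1) by (auto simp: S_def signed_partition_of_def partition_of_def negative_parts_def)
  qed
  have disj: "signed_parts k n \<inter> signed_parts m n = {}" if "k \<noteq> m" for k m
    using that by (auto simp: signed_parts_def negative_parts_def)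
  have empty: "signed_parts m n = {}" if "n < m" for m
  proof -
    have "0 < m" "n < m^2 + m" using that by auto
    hence "of_nat (card (signed_parts m n)) = (0::rat)"
      unfolding card_signed_parts[OF \<open>0 < m\<close>] mult.assoc by (simp add: fps_X_power_mult_nth)
    thus ?thesis using card_signed_parts_coeff(1)[OF \<open>0 < m\<close>] by simp
  qed
  have S: "S = (\<Union>m\<in>{1..n}. signed_parts m n)"
  proof (rule set_eqI, clarify)
    fix p v
    have "m \<le> n" if "(p, v) \<in> signed_parts m n" for m
      using empty[of m] that by (cases "n < m") auto
    thus "(p, v) \<in> S \<longleftrightarrow> (p, v) \<in> (\<Union>m\<in>{1..n}. signed_parts m n)"
      unfolding mem by (auto simp: Suc_le_eq)
  qed
  have fin: "finite (signed_parts m n)" if "m \<in> {1..n}" for m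
    using that by (intro card_signed_parts_coeff(1)) auto
  have "card S = (\<Sum>m=1..n. card (signed_parts m n))"
    unfolding S using fin disj by (intro card_UN_disjoint) auto
  hence "of_nat (card S) = (\<Sum>m=1..n. fps_nth (?t m) n)"
    by (simp add: card_signed_parts)
  also have "\<dots> = (\<Sum>m<n+1. fps_nth (?t m) n)"
  proof (rule sum.mono_neutral_left)
    \<comment> \<open>The series also has a term m = 0, which only affects the constant coefficient.\<close>
    have "?t 0 = 1" by (simp add: phi6_prod_def rqfact_def)
    thus "\<forall>m\<in>{..<n+1} - {1..n}. fps_nth (?t m) n = 0" using assms(1) by (auto simp: not_le)
  qed auto
  also have "\<dots> = fps_nth (\<Sum>m<n+1. ?t m) n" by (simp only: fps_sum_nth)
  also have "\<dots> = fps_nth (\<Prod>j\<in>{j\<in>{1..18*(n+1)}. allowed j}. inverse (1 - fps_X ^ j)) n"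
    using agree_trans[OF agree_bailey agree_product, of "n+1"] by (simp add: agree_def)
  also have "\<dots> = of_nat (card {xs. partition_of n xs \<and> (\<forall>j\<in>set xs. allowed j)})"
    by (rule card_allowed_partitions[symmetric]) simp
  finally have "card S = card {xs. partition_of n xs \<and> (\<forall>j\<in>set xs. allowed j)}"
    by (simp only: of_nat_eq_iff)
  moreover have "finite S" unfolding S using fin by blast
  ultimately show ?thesis unfolding allowed_iff by blast
qed

end
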